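(* Each Heun class operator can be transformed, by the allowed transformations listed in the context, into a Riemann class operator or into an operator $\sigma(z)\partial_z^2+\tau(z)\partial_z+\eta(z)$ having one of the following normal forms, where $c$ denotes an arbitrary nonzero constant (the symbol in front is the name of the type; the coefficients $a_i,b_i,t$ are complex parameters subject to the indicated restrictions; where two possibilities a), b) are given for $\eta$, they are alternative normal forms of the same type): 1. $(\underline1\,\underline1\,\underline1;\underline1)$: $\sigma=z(z-1)(z-t)$, $\tau=a_2z^2+a_1z+a_0$, $\eta$ = a) $b_1z+b_0$ or b) $b_0+b_{-1}z^{-1}$; $t\neq0,1$. 2. $(\underline1\,\underline1;2)$: $\sigma=z(z-1)$, $\tau=a_2z^2+a_1z+a_0$, $\eta$ = a) $b_1z+b_0$ or b) $b_0+b_{-1}z^{-1}$; $a_2\neq0$. 3. $(2\,\underline1;\underline1)$: $\sigma=z^2(z-1)$, $\tau=a_2z^2+a_1z+a_0$, $\eta$ = a) $b_1z+b_0$ or b) $b_0+b_{-1}z^{-1}$; $a_0\neq0$. 4. $(\underline1\,\underline1;\frac32)$: $\sigma=z(z-1)$, $\tau=a_1z+a_0$, $\eta=b_1z+b_0$; $b_1\neq0$. 5. $(\frac32\,\underline1;\underline1)$: $\sigma=z^2(z-1)$, $\tau=a_2z^2+a_1z$, $\eta=b_0+b_{-1}z^{-1}$; $b_{-1}\neq0$. 6. $(2;2)$: $\sigma=z^2$, $\tau=a_2z^2+a_1z+a_0$, $\eta$ = a) $b_1z+b_0$ or b) $b_0+b_{-1}z^{-1}$; $a_2\neq0$, $a_0=c$.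 7. $(\frac32;2)$: $\sigma=z^2$, $\tau=a_2z^2+a_1z$, $\eta=b_0+b_{-1}z^{-1}$; $b_{-1}\neq0$, $a_2=c$. 8. $(2;\frac32)$: $\sigma=z^2$, $\tau=a_1z+a_0$, $\eta=b_1z+b_0$; $b_1\neq0$, $a_0=c$. 9. $(\frac32;\frac32)$: $\sigma=z^2$, $\tau=0$, $\eta=b_1z+b_0+b_{-1}z^{-1}$; $b_{-1}\neq0$, $b_1=c$. 10. $(1;\frac32)$: $\sigma=z^2$, $\tau=a_1z$, $\eta=b_1z$; $b_1=c$. 11. $(\frac32;1)$: $\sigma=z^2$, $\tau=a_1z$, $\eta=b_{-1}z^{-1}$; $b_{-1}=c$. 12. $(\underline1;3)$: $\sigma=z$, $\tau=a_2z^2+a_1z+a_0$, $\eta$ = a) $b_1z+b_0$ or b) $b_0+b_{-1}z^{-1}$; $a_2=c$. 13. $(3;\underline1)$: $\sigma=z^3$, $\tau=a_2z^2+a_1z+a_0$, $\eta$ = a) $b_1z+b_0$ or b) $b_0+b_{-1}z^{-1}$; $a_0=c$. 14. $(\underline1;\frac52)$: $\sigma=z$, $\tau=a_0$, $\eta=b_2z^2+b_1z+b_0$; $b_2=c$. 15. $(\frac52;\underline1)$: $\sigma=z^3$, $\tau=a_2z^2$, $\eta=b_0+b_{-1}z^{-1}+b_{-2}z^{-2}$; $b_{-2}=c$. 16. $(;4)$: $\sigma=1$, $\tau=a_2z^2+a_0$, $\eta=b_1z+b_0$; $a_2=c$. 17. $(;\frac72)$: $\sigma=1$, $\tau=0$,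 $\eta=b_3z^3+b_1z+b_0$; $b_3=c$.
   Context: A Heun class operator is a differential operator $\sigma(z)\partial_z^2+\tau(z)\partial_z+\eta(z)$ with $\eta=\xi/\sigma$, where $\sigma,\tau,\xi$ are complex polynomials in $z$ with $\sigma\neq0$, $\deg\sigma\le3$, $\deg\tau\le2$, $\deg\xi\le4$. A Riemann class operator is an operator of the same shape with $\sigma\neq0$, $\deg\sigma\le2$, $\deg\tau\le1$, $\deg\xi\le2$. Allowed transformations: changes of variable $z\mapsto az+b$; division of the operator by a constant; sandwiching with powers, $A\mapsto (z-z_0)^{-\kappa}A(z-z_0)^{\kappa}$; sandwiching with exponentials, $A\mapsto \mathrm{e}^{-r}A\,\mathrm{e}^{r}$ with $r(z)=\kappa z^{k}$ or $r(z)=\kappa(z-z_0)^{-k}$, $k=1,2,\dots$, $\kappa\in\mathbb{C}$. (There is some arbitrariness in the choice of a normal form.) The type symbols are names: they list the ranks of the singularities, the one at $\infty$ being put after the semicolon, and $\underline1$ stands for a Fuchsian (regular) singularity.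
   Formalization: A third outcome is added, since the claim fails e.g. for z²(z−1)∂_z²: the operator may transform into z times a Riemann class operator R with σ_R(0)=0 and either deg σ_R=2, or deg τ_R=1 and deg ξ_R≤1; these are exactly cases with no listed form. *)

theory Defs
  imports "HOL-Complex_Analysis.Complex_Analysis"
          "HOL-Computational_Algebra.Polynomial"
begin

type_synonym operator = "(complex \<Rightarrow> complex) \<Rightarrow> complex \<Rightarrow> complex"

definition diffop ::
  "(complex \<Rightarrow> complex) \<Rightarrow> (complex \<Rightarrow> complex) \<Rightarrow> (complex \<Rightarrow> complex) \<Rightarrow> operator" where
  "diffop \<sigma> \<tau> \<eta> = (\<lambda>f z. \<sigma> z * deriv (deriv f) z + \<tau> z * deriv f z + \<eta> z * f z)"

definition poly_op :: "complex poly \<Rightarrow> complex poly \<Rightarrow> complex poly \<Rightarrow> operator" where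
  "poly_op \<sigma> \<tau> \<xi> = diffop (poly \<sigma>) (poly \<tau>) (\<lambda>z. poly \<xi> z / poly \<sigma> z)"

definition heun_class :: "operator \<Rightarrow> bool" where
  "heun_class A \<longleftrightarrow> (\<exists>\<sigma> \<tau> \<xi>. \<sigma> \<noteq> 0 \<and> degree \<sigma> \<le> 3 \<and> degree \<tau> \<le> 2 \<and> degree \<xi> \<le> 4
     \<and> A = poly_op \<sigma> \<tau> \<xi>)"

definition riemann_class :: "operator \<Rightarrow> bool" where
  "riemann_class A \<longleftrightarrow> (\<exists>\<sigma> \<tau> \<xi>. \<sigma> \<noteq> 0 \<and> degree \<sigma> \<le> 2 \<and> degree \<tau> \<le> 1 \<and> degree \<xi> \<le> 2
     \<and> A = poly_op \<sigma> \<tau> \<xi>)"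

text \<open>
  Equality of operators with rational coefficients: they act in the same way on germs of
  analytic functions, away from finitely many points. The exceptional points absorb the
  poles of the coefficients, where the value of a quotient is a convention of the logic.
\<close>

definition op_eq :: "operator \<Rightarrow> operator \<Rightarrow> bool" (infix "\<approx>" 50) where
  "A \<approx> B \<longleftrightarrow> (\<exists>S. finite S \<and> (\<forall>z f. z \<notin> S \<longrightarrow> f analytic_on {z} \<longrightarrow> A f z = B f z))"

text \<open>
  \<open>w\<close> is, near \<open>z\<close>, a branch of the multivalued function \<open>(u - z0)\<close> to the power \<open>\<kappa>\<close>,
  given by the branch \<open>l\<close> of \<open>log (u - z0)\<close>. Such a \<open>w\<close> exists for every \<open>z \<noteq> z0\<close>, and two
  of them differ near \<open>z\<close> by a nonzero constant factor, so that the result of sandwiching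
  with \<open>w\<close> does not depend on the branch.
\<close>

definition power_branch ::
  "complex \<Rightarrow> complex \<Rightarrow> (complex \<Rightarrow> complex) \<Rightarrow> complex \<Rightarrow> bool" where
  "power_branch z0 \<kappa> w z \<longleftrightarrow> (\<exists>l. l analytic_on {z} \<and>
     (\<forall>\<^sub>F u in nhds z. exp (l u) = u - z0 \<and> w u = exp (\<kappa> * l u)))"

definition power_sandwich :: "complex \<Rightarrow> complex \<Rightarrow> operator \<Rightarrow> operator \<Rightarrow> bool" where
  "power_sandwich z0 \<kappa> A B \<longleftrightarrow> (\<exists>S. finite S \<and>
     (\<forall>z f w. z \<notin> S \<longrightarrow> f analytic_on {z} \<longrightarrow> power_branch z0 \<kappa> w z \<longrightarrow>
        B f z = inverse (w z) * A (\<lambda>u. w u * f u) z))"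

definition exp_sandwich :: "(complex \<Rightarrow> complex) \<Rightarrow> operator \<Rightarrow> operator" where
  "exp_sandwich r A = (\<lambda>f z. exp (- r z) * A (\<lambda>u. exp (r u) * f u) z)"

text \<open>
  The change of variable \<open>w = a * z + b\<close> turns a function \<open>f\<close> of \<open>z\<close> into the function
  \<open>f ((w - b) / a)\<close> of \<open>w\<close>.
\<close>

definition affine_change :: "complex \<Rightarrow> complex \<Rightarrow> operator \<Rightarrow> operator" where
  "affine_change a b A = (\<lambda>f z. A (\<lambda>w. f ((w - b) / a)) (a * z + b))"

inductive allowed_step :: "operator \<Rightarrow> operator \<Rightarrow> bool" where
  affine: "a \<noteq> 0 \<Longrightarrow> B \<approx> affine_change a b A \<Longrightarrow> allowed_step A B"
| divide: "k \<noteq> 0 \<Longrightarrow> B \<approx> (\<lambda>f z. A f z / k) \<Longrightarrow> allowed_step A B"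
| power: "power_sandwich z0 \<kappa> A B \<Longrightarrow> allowed_step A B"
| exp_infinity: "k \<ge> 1 \<Longrightarrow> B \<approx> exp_sandwich (\<lambda>z. \<kappa> * z ^ k) A \<Longrightarrow> allowed_step A B"
| exp_finite: "k \<ge> 1 \<Longrightarrow> B \<approx> exp_sandwich (\<lambda>z. \<kappa> / (z - z0) ^ k) A \<Longrightarrow> allowed_step A B"

abbreviation transforms_to :: "operator \<Rightarrow> operator \<Rightarrow> bool" (infix "\<leadsto>" 50) where
  "A \<leadsto> B \<equiv> allowed_step\<^sup>*\<^sup>* A B"

text \<open>
  The constructors spell the type symbols: \<open>u1\<close> is the underlined 1 (a Fuchsian
  singularity), \<open>3h\<close>, \<open>5h\<close>, \<open>7h\<close> are the ranks 3/2, 5/2, 7/2, and the rank at infinity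
  comes after the semicolon, here a double underscore.
\<close>

datatype heun_type =
    T_u1_u1_u1__u1
  | T_u1_u1__2
  | T_2_u1__u1
  | T_u1_u1__3h
  | T_3h_u1__u1
  | T_2__2
  | T_3h__2
  | T_2__3h
  | T_3h__3h
  | T_1__3h
  | T_3h__1
  | T_u1__3
  | T_3__u1
  | T_u1__5h
  | T_5h__u1
  | T__4
  | T__7h

datatype variant = Form_a | Form_b

fun eta_form :: "variant \<Rightarrow> complex \<Rightarrow> complex \<Rightarrow> complex \<Rightarrow> complex" where
  "eta_form Form_a b0 b = (\<lambda>z. b * z + b0)"
| "eta_form Form_b b0 b = (\<lambda>z. b0 + b / z)"

text \<open>
  The argument \<open>v\<close> selects one of the two alternative forms of \<open>\<eta>\<close>, and is irrelevant for
  the types that have only one; likewise \<open>c\<close>, the constant to which one coefficient is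
  normalized. The parameters \<open>bm1\<close>, \<open>bm2\<close> are the coefficients of the powers -1, -2 of \<open>z\<close>.
\<close>

inductive normal_form :: "variant \<Rightarrow> complex \<Rightarrow> heun_type \<Rightarrow> operator \<Rightarrow> bool"
  for v :: variant and c :: complex where
  "t \<noteq> 0 \<Longrightarrow> t \<noteq> 1 \<Longrightarrow> normal_form v c T_u1_u1_u1__u1
     (diffop (\<lambda>z. z * (z - 1) * (z - t)) (\<lambda>z. a2 * z\<^sup>2 + a1 * z + a0) (eta_form v b0 b))"
| "a2 \<noteq> 0 \<Longrightarrow> normal_form v c T_u1_u1__2
     (diffop (\<lambda>z. z * (z - 1)) (\<lambda>z. a2 * z\<^sup>2 + a1 * z + a0) (eta_form v b0 b))"
| "a0 \<noteq> 0 \<Longrightarrow> normal_form v c T_2_u1__u1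
     (diffop (\<lambda>z. z\<^sup>2 * (z - 1)) (\<lambda>z. a2 * z\<^sup>2 + a1 * z + a0) (eta_form v b0 b))"
| "b1 \<noteq> 0 \<Longrightarrow> normal_form v c T_u1_u1__3h
     (diffop (\<lambda>z. z * (z - 1)) (\<lambda>z. a1 * z + a0) (\<lambda>z. b1 * z + b0))"
| "bm1 \<noteq> 0 \<Longrightarrow> normal_form v c T_3h_u1__u1
     (diffop (\<lambda>z. z\<^sup>2 * (z - 1)) (\<lambda>z. a2 * z\<^sup>2 + a1 * z) (\<lambda>z. b0 + bm1 / z))"
| "a2 \<noteq> 0 \<Longrightarrow> a0 = c \<Longrightarrow> normal_form v c T_2__2
     (diffop (\<lambda>z. z\<^sup>2) (\<lambda>z. a2 * z\<^sup>2 + a1 * z + a0) (eta_form v b0 b))"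
| "bm1 \<noteq> 0 \<Longrightarrow> a2 = c \<Longrightarrow> normal_form v c T_3h__2
     (diffop (\<lambda>z. z\<^sup>2) (\<lambda>z. a2 * z\<^sup>2 + a1 * z) (\<lambda>z. b0 + bm1 / z))"
| "b1 \<noteq> 0 \<Longrightarrow> a0 = c \<Longrightarrow> normal_form v c T_2__3h
     (diffop (\<lambda>z. z\<^sup>2) (\<lambda>z. a1 * z + a0) (\<lambda>z. b1 * z + b0))"
| "bm1 \<noteq> 0 \<Longrightarrow> b1 = c \<Longrightarrow> normal_form v c T_3h__3h
     (diffop (\<lambda>z. z\<^sup>2) (\<lambda>z. 0) (\<lambda>z. b1 * z + b0 + bm1 / z))"
| "b1 = c \<Longrightarrow> normal_form v c T_1__3h
     (diffop (\<lambda>z. z\<^sup>2) (\<lambda>z. a1 * z) (\<lambda>z. b1 * z))"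
| "bm1 = c \<Longrightarrow> normal_form v c T_3h__1
     (diffop (\<lambda>z. z\<^sup>2) (\<lambda>z. a1 * z) (\<lambda>z. bm1 / z))"
| "a2 = c \<Longrightarrow> normal_form v c T_u1__3
     (diffop (\<lambda>z. z) (\<lambda>z. a2 * z\<^sup>2 + a1 * z + a0) (eta_form v b0 b))"
| "a0 = c \<Longrightarrow> normal_form v c T_3__u1
     (diffop (\<lambda>z. z ^ 3) (\<lambda>z. a2 * z\<^sup>2 + a1 * z + a0) (eta_form v b0 b))"
| "b2 = c \<Longrightarrow> normal_form v c T_u1__5h
     (diffop (\<lambda>z. z) (\<lambda>z. a0) (\<lambda>z. b2 * z\<^sup>2 + b1 * z + b0))"
| "bm2 = c \<Longrightarrow> normal_form v c T_5h__u1
     (diffop (\<lambda>z. z ^ 3) (\<lambda>z. a2 * z\<^sup>2) (\<lambda>z. b0 + bm1 / z + bm2 / z\<^sup>2))"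
| "a2 = c \<Longrightarrow> normal_form v c T__4
     (diffop (\<lambda>z. 1) (\<lambda>z. a2 * z\<^sup>2 + a0) (\<lambda>z. b1 * z + b0))"
| "b3 = c \<Longrightarrow> normal_form v c T__7h
     (diffop (\<lambda>z. 1) (\<lambda>z. 0) (\<lambda>z. b3 * z ^ 3 + b1 * z + b0))"

text \<open>
  Operators \<open>z * R\<close> with \<open>R\<close> of Riemann class, where \<open>z\<close> divides the coefficient \<open>\<sigma>\<close> of \<open>R\<close>,
  and \<open>R\<close> has degree of \<open>\<sigma>\<close> equal to 2, or degree of \<open>\<tau>\<close> equal to 1 and polynomial \<open>\<eta>\<close>
  up to a simple pole at 0. They are of Heun class and their equation is a Riemann class
  equation. But the factor \<open>z\<close> cannot be removed by allowed transformations, which permit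
  division by constants only: \<open>z\<^sup>2 * (z - 1)\<close> times the second derivative is such an
  operator, and it transforms neither into a Riemann class operator (the degree of \<open>\<sigma>\<close>
  stays 3) nor into a normal form of type \<open>T_2_u1__u1\<close> or \<open>T_3h_u1__u1\<close>, the only ones whose
  \<open>\<sigma>\<close> has one double and one simple zero. The restriction on the degrees excludes the
  operators \<open>z * R\<close> that do have a normal form, such as those of type \<open>T_1__3h\<close>.
\<close>

definition z_times_riemann :: "operator \<Rightarrow> bool" where
  "z_times_riemann B \<longleftrightarrow> (\<exists>\<sigma> \<tau> \<xi>. \<sigma> \<noteq> 0 \<and> degree \<sigma> \<le> 2 \<and> degree \<tau> \<le> 1 \<and> degree \<xi> \<le> 2
     \<and> poly \<sigma> 0 = 0 \<and> (degree \<sigma> = 2 \<or> degree \<tau> = 1 \<and> degree \<xi> \<le> 1)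
     \<and> B = (\<lambda>f z. z * poly_op \<sigma> \<tau> \<xi> f z))"

end

theory Submission
  imports Defs "HOL-Computational_Algebra.Fundamental_Theorem_Algebra"
begin

text \<open>
  Conjugation by a function \<open>w\<close> with \<open>w' = h w\<close> replaces the derivation by the derivation plus
  \<open>h\<close>. A rational \<open>h\<close> is a sum of partial fractions, and each of them is the logarithmic
  derivative of a function with which sandwiching is allowed: a simple pole comes from a power, a
  higher pole or a monomial from an exponential. Hence \<open>h = p / \<sigma>\<close> is available for every
  polynomial \<open>p\<close> (\<open>poly_op_sandwich\<close>), and it sends \<open>(\<sigma>, \<tau>, \<xi>)\<close> to
  \<open>(\<sigma>, \<tau> + 2 p, \<xi> + \<tau> p + p\<^sup>2 + p' \<sigma> - p \<sigma>')\<close>.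

  Affine changes of variable and division by constants bring \<open>\<sigma>\<close>, according to the multiplicities
  of its zeros, to one of the seven polynomials \<open>z (z - 1) (z - t)\<close>, \<open>z\<^sup>2 (z - 1)\<close>, \<open>z\<^sup>3\<close>,
  \<open>z (z - 1)\<close>, \<open>z\<^sup>2\<close>, \<open>z\<close>, \<open>1\<close>. It remains to choose \<open>p = p0 + p1 z + p2 z\<^sup>2\<close>. The new \<open>\<xi>\<close>
  vanishes at a zero of \<open>\<sigma>\<close> if the value of \<open>p\<close> there solves a quadratic equation, and its
  coefficient of \<open>z\<^sup>4\<close> vanishes if \<open>p2\<close> solves one; such equations always have a root. At a
  multiple zero, placed at 0, the equation is \<open>\<xi>(0) + \<tau>(0) p0 + p0\<^sup>2 = 0\<close>, and for \<open>deg \<sigma> \<le> 2\<close>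
  the equation at infinity is similarly \<open>x4 + t2 p2 + p2\<^sup>2 = 0\<close>. If the discriminant is nonzero, the
  new value \<open>t0 + 2 p0\<close> of \<open>\<tau>\<close> (respectively \<open>t2 + 2 p2\<close>) is nonzero, the singularity has integer
  rank, and further coefficients of \<open>\<xi>\<close> depend on the other coefficients of \<open>p\<close> by linear equations
  that are solvable because that number is their leading coefficient. If the discriminant is zero,
  \<open>\<tau>\<close> and \<open>\<xi>\<close> lose their extreme coefficients together, and the next coefficient of \<open>\<xi>\<close>, which no
  longer depends on \<open>p\<close>, decides. If it is nonzero, the rank is a half-integer. If it vanishes at
  infinity, the operator is of Riemann class; if it vanishes at 0, the operator is \<open>z\<close> times one of
  Riemann class, or, when \<open>\<sigma> = z\<^sup>2\<close> and infinity has rank 3/2, of the type with rank 1 at 0.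

  The two alternative forms of \<open>\<eta>\<close> differ in whether \<open>\<xi>\<close> is made to vanish further at 0 or to have
  smaller degree. If \<open>\<sigma>\<close> has at most one zero, a scaling remains, which normalizes one coefficient
  to \<open>c\<close>, if necessary by extracting a root; for constant \<open>\<sigma>\<close> also a shift remains, which removes a
  further coefficient.
\<close>

section \<open>Equality of operators\<close>

lemma op_eq_sym: "op_eq A B \<Longrightarrow> op_eq B A"
  unfolding op_eq_def by metis

text \<open>
  Division by 1 is an allowed step, and each step determines its result only up to finitely many
  points.
\<close>
lemma op_eq_step:
  assumes "op_eq A B"
  shows "A \<leadsto> B"
proof -
  have "op_eq B (\<lambda>f z. A f z / 1)"
    using op_eq_sym[OF assms] by simp
  then show ?thesis
    by (intro r_into_rtranclp allowed_step.divide[of 1]) auto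
qed

lemma diffop_op_eqI:
  assumes "finite S"
    and "\<And>z. z \<notin> S \<Longrightarrow> \<sigma> z = \<sigma>' z" "\<And>z. z \<notin> S \<Longrightarrow> \<tau> z = \<tau>' z" "\<And>z. z \<notin> S \<Longrightarrow> \<eta> z = \<eta>' z"
  shows "diffop \<sigma> \<tau> \<eta> \<approx> diffop \<sigma>' \<tau>' \<eta>'"
  unfolding op_eq_def diffop_def using assms by (intro exI[of _ S]) auto

section \<open>Sandwiching with a function of rational logarithmic derivative\<close>

lemma eventually_analytic_nhds:
  assumes "f analytic_on {z}"
  shows "\<forall>\<^sub>F u in nhds z. f analytic_on {u}"
proof -
  obtain s where "open s" "z \<in> s" "f holomorphic_on s"
    using assms unfolding analytic_at by auto
  then show ?thesis
    unfolding eventually_nhds analytic_at by blast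
qed

lemma analytic_at_has_deriv:
  assumes "f analytic_on {z}"
  shows "(f has_field_derivative deriv f z) (at z)"
  using assms analytic_on_imp_differentiable_at DERIV_deriv_iff_field_differentiable by blast

text \<open>
  If \<open>w' = h w\<close>, then \<open>(w f)' = w (f' + h f)\<close>: conjugation by \<open>w\<close> replaces the derivation by
  the derivation plus \<open>h\<close>, and squaring this gives the new coefficients.
\<close>

lemma diffop_sandwich:
  assumes w: "w analytic_on {z}" and h: "h analytic_on {z}" and f: "f analytic_on {z}"
    and wh: "\<forall>\<^sub>F u in nhds z. deriv w u = w u * h u"
  shows "diffop \<sigma> \<tau> \<eta> (\<lambda>u. w u * f u) z
    = w z * diffop \<sigma> (\<lambda>z. \<tau> z + 2 * \<sigma> z * h z)
        (\<lambda>z. \<eta> z + \<tau> z * h z + \<sigma> z * ((h z)\<^sup>2 + deriv h z)) f z"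
proof -
  have d1: "\<forall>\<^sub>F u in nhds z. deriv (\<lambda>u. w u * f u) u = w u * (h u * f u + deriv f u)"
    using eventually_analytic_nhds[OF w] eventually_analytic_nhds[OF f] wh
  proof eventually_elim
    case (elim u)
    show ?case
      by (rule DERIV_imp_deriv)
        (auto intro!: derivative_eq_intros analytic_at_has_deriv elim simp: elim algebra_simps)
  qed
  have f': "deriv f analytic_on {z}"
    using f by (rule analytic_deriv)
  have "deriv (deriv (\<lambda>u. w u * f u)) z = deriv (\<lambda>u. w u * (h u * f u + deriv f u)) z"
    by (rule deriv_cong_ev[OF d1 refl])
  also have "\<dots> = w z * (((h z)\<^sup>2 + deriv h z) * f z + 2 * h z * deriv f z + deriv (deriv f) z)"
    by (rule DERIV_imp_deriv)
      (auto intro!: derivative_eq_intros analytic_at_has_deriv w h f f'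
        simp: eventually_nhds_x_imp_x[OF wh] algebra_simps power2_eq_square)
  finally show ?thesis
    unfolding diffop_def eventually_nhds_x_imp_x[OF d1]
    by (simp add: algebra_simps power2_eq_square)
qed

text \<open>
  \<open>h\<close> stands for the logarithmic derivative of the sandwiching function. The function itself may be
  multivalued, whereas \<open>h\<close> and the transformed coefficients are not. Several steps in succession
  add their logarithmic derivatives.
\<close>
definition sandwichable :: "(complex \<Rightarrow> complex) \<Rightarrow> bool" where
  "sandwichable h \<longleftrightarrow> (\<exists>S. finite S \<and> (\<forall>z. z \<notin> S \<longrightarrow> h analytic_on {z})) \<and>
     (\<forall>\<sigma> \<tau> \<eta>. diffop \<sigma> \<tau> \<eta> \<leadsto> diffop \<sigma> (\<lambda>z. \<tau> z + 2 * \<sigma> z * h z)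
        (\<lambda>z. \<eta> z + \<tau> z * h z + \<sigma> z * ((h z)\<^sup>2 + deriv h z)))"

lemma sandwichable_cong:
  assumes h: "sandwichable h" and S: "finite S" and eq: "\<And>z. z \<notin> S \<Longrightarrow> h z = g z"
  shows "sandwichable g"
proof -
  from h obtain T where T: "finite T" "\<And>z. z \<notin> T \<Longrightarrow> h analytic_on {z}"
    and tr: "\<And>\<sigma> \<tau> \<eta>. diffop \<sigma> \<tau> \<eta> \<leadsto> diffop \<sigma> (\<lambda>z. \<tau> z + 2 * \<sigma> z * h z)
        (\<lambda>z. \<eta> z + \<tau> z * h z + \<sigma> z * ((h z)\<^sup>2 + deriv h z))"
    unfolding sandwichable_def by blast
  have ev: "\<forall>\<^sub>F u in nhds z. h u = g u" if "z \<notin> S" for z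
  proof -
    have "\<forall>\<^sub>F u in nhds z. u \<in> - S"
      using S that by (intro eventually_nhds_in_open) (auto intro: finite_imp_closed)
    then show ?thesis by eventually_elim (use eq in auto)
  qed
  have an: "g analytic_on {z}" if "z \<notin> S \<union> T" for z
    using T(2)[of z] ev[of z] that analytic_at_cong[of h g z z] by auto
  have dv: "deriv h z = deriv g z" if "z \<notin> S" for z
    by (rule deriv_cong_ev[OF ev[OF that] refl])
  have "diffop \<sigma> \<tau> \<eta> \<leadsto> diffop \<sigma> (\<lambda>z. \<tau> z + 2 * \<sigma> z * g z)
        (\<lambda>z. \<eta> z + \<tau> z * g z + \<sigma> z * ((g z)\<^sup>2 + deriv g z))" for \<sigma> \<tau> \<eta>
    by (rule rtranclp_trans[OF tr op_eq_step], rule diffop_op_eqI[OF S]) (simp_all add: eq dv)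
  then show ?thesis
    unfolding sandwichable_def using an S T(1) by (intro conjI exI[of _ "S \<union> T"]) auto
qed

lemma sandwichable_add:
  assumes "sandwichable h" "sandwichable g"
  shows "sandwichable (\<lambda>z. h z + g z)"
proof -
  from assms(1) obtain T where T: "finite T" "\<And>z. z \<notin> T \<Longrightarrow> h analytic_on {z}"
    and tr: "\<And>\<sigma> \<tau> \<eta>. diffop \<sigma> \<tau> \<eta> \<leadsto> diffop \<sigma> (\<lambda>z. \<tau> z + 2 * \<sigma> z * h z)
        (\<lambda>z. \<eta> z + \<tau> z * h z + \<sigma> z * ((h z)\<^sup>2 + deriv h z))"
    unfolding sandwichable_def by blast
  from assms(2) obtain T' where T': "finite T'" "\<And>z. z \<notin> T' \<Longrightarrow> g analytic_on {z}"
    and tr': "\<And>\<sigma> \<tau> \<eta>. diffop \<sigma> \<tau> \<eta> \<leadsto> diffop \<sigma> (\<lambda>z. \<tau> z + 2 * \<sigma> z * g z)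
        (\<lambda>z. \<eta> z + \<tau> z * g z + \<sigma> z * ((g z)\<^sup>2 + deriv g z))"
    unfolding sandwichable_def by blast
  have fin: "finite (T \<union> T')" using T T' by simp
  have an: "(\<lambda>z. h z + g z) analytic_on {z}" if "z \<notin> T \<union> T'" for z
    using T(2)[of z] T'(2)[of z] that by (auto intro: analytic_intros)
  have dv: "deriv (\<lambda>z. h z + g z) z = deriv h z + deriv g z" if "z \<notin> T \<union> T'" for z
    using T(2)[of z] T'(2)[of z] that
    by (intro DERIV_imp_deriv) (auto intro!: derivative_eq_intros analytic_at_has_deriv)
  have "diffop \<sigma> \<tau> \<eta> \<leadsto> diffop \<sigma> (\<lambda>z. \<tau> z + 2 * \<sigma> z * (h z + g z))
        (\<lambda>z. \<eta> z + \<tau> z * (h z + g z) + \<sigma> z * ((h z + g z)\<^sup>2 + deriv (\<lambda>z. h z + g z) z))"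
    for \<sigma> \<tau> \<eta>
    by (rule rtranclp_trans[OF tr rtranclp_trans[OF tr' op_eq_step]], rule diffop_op_eqI[OF fin])
      (simp_all add: dv, simp_all add: algebra_simps power2_eq_square)
  then show ?thesis
    unfolding sandwichable_def using an fin by blast
qed

text \<open>Common to the two kinds of exponential sandwich, with exponent \<open>r\<close>.\<close>
lemma sandwichable_exp:
  assumes S: "finite S" and h: "\<And>z. z \<notin> S \<Longrightarrow> h analytic_on {z}"
    and r: "\<And>z. z \<notin> S \<Longrightarrow> r analytic_on {z}" "\<And>z. z \<notin> S \<Longrightarrow> deriv r z = h z"
    and step: "\<And>A B. B \<approx> exp_sandwich r A \<Longrightarrow> allowed_step A B"
  shows "sandwichable h"
proof -
  have "diffop \<sigma> \<tau> \<eta> \<leadsto> diffop \<sigma> (\<lambda>z. \<tau> z + 2 * \<sigma> z * h z)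
        (\<lambda>z. \<eta> z + \<tau> z * h z + \<sigma> z * ((h z)\<^sup>2 + deriv h z))" for \<sigma> \<tau> \<eta>
  proof (rule r_into_rtranclp, rule step, unfold op_eq_def, intro exI[of _ S] conjI allI impI S)
    fix z f assume z: "z \<notin> S" and f: "f analytic_on {z}"
    have "\<forall>\<^sub>F u in nhds z. u \<in> - S"
      using S z by (intro eventually_nhds_in_open) (auto intro: finite_imp_closed)
    then have ev: "\<forall>\<^sub>F u in nhds z. deriv (\<lambda>u. exp (r u)) u = exp (r u) * h u"
    proof eventually_elim
      case (elim u)
      then show ?case
        using r[of u] analytic_at_has_deriv[of r u]
        by (intro DERIV_imp_deriv) (auto intro!: derivative_eq_intros)
    qed
    have "(\<lambda>u. exp (r u)) analytic_on {z}"
      using r(1)[OF z] by (intro analytic_intros)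
    from diffop_sandwich[OF this h[OF z] f ev]
    show "diffop \<sigma> (\<lambda>z. \<tau> z + 2 * \<sigma> z * h z)
        (\<lambda>z. \<eta> z + \<tau> z * h z + \<sigma> z * ((h z)\<^sup>2 + deriv h z)) f z
        = exp_sandwich r (diffop \<sigma> \<tau> \<eta>) f z"
      by (simp add: exp_sandwich_def exp_minus)
  qed
  then show ?thesis
    unfolding sandwichable_def using h S by blast
qed

lemma sandwichable_monomial: "sandwichable (\<lambda>z. \<kappa> * z ^ n)"
proof (rule sandwichable_exp[of "{}" _ "\<lambda>z. \<kappa> / of_nat (Suc n) * z ^ Suc n"])
  fix z :: complex
  show "deriv (\<lambda>z. \<kappa> / of_nat (Suc n) * z ^ Suc n) z = \<kappa> * z ^ n"
    using DERIV_cmult[OF DERIV_power[OF DERIV_ident, of "Suc n" z], of "\<kappa> / of_nat (Suc n)"]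
    by (intro DERIV_imp_deriv) (simp del: of_nat_Suc power_Suc)
next
  show "allowed_step A B" if "B \<approx> exp_sandwich (\<lambda>z. \<kappa> / of_nat (Suc n) * z ^ Suc n) A" for A B
    by (rule allowed_step.exp_infinity[OF _ that]) simp
qed (auto intro!: analytic_intros simp del: of_nat_Suc)

lemma sandwichable_simple_pole: "sandwichable (\<lambda>z. \<kappa> / (z - z0))"
proof -
  let ?h = "\<lambda>z. \<kappa> / (z - z0)"
  have an: "?h analytic_on {z}" if "z \<notin> {z0}" for z
    using that by (auto intro!: analytic_intros)
  have "diffop \<sigma> \<tau> \<eta> \<leadsto> diffop \<sigma> (\<lambda>z. \<tau> z + 2 * \<sigma> z * ?h z)
        (\<lambda>z. \<eta> z + \<tau> z * ?h z + \<sigma> z * ((?h z)\<^sup>2 + deriv ?h z))" for \<sigma> \<tau> \<eta>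
  proof (rule r_into_rtranclp, rule allowed_step.power[of z0 \<kappa>], unfold power_sandwich_def,
      intro exI[of _ "{z0}"] conjI allI impI)
    fix z f w
    assume z: "z \<notin> {z0}" and f: "f analytic_on {z}" and "power_branch z0 \<kappa> w z"
    then obtain l where l: "l analytic_on {z}"
      and lw: "\<forall>\<^sub>F u in nhds z. exp (l u) = u - z0 \<and> w u = exp (\<kappa> * l u)"
      unfolding power_branch_def by blast
    have lw': "\<forall>\<^sub>F u in nhds z. \<forall>\<^sub>F v in nhds u. exp (l v) = v - z0 \<and> w v = exp (\<kappa> * l v)"
      using lw by (simp only: eventually_eventually)
    have ev: "\<forall>\<^sub>F u in nhds z. deriv w u = w u * ?h u"
      using eventually_analytic_nhds[OF l] lw'
    proof eventually_elim
      case (elim u)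
      have ul: "exp (l u) = u - z0" and uw: "w u = exp (\<kappa> * l u)"
        using eventually_nhds_x_imp_x[OF elim(2)] by auto
      have dl: "(l has_field_derivative deriv l u) (at u)"
        using elim(1) by (rule analytic_at_has_deriv)
      \<comment> \<open>Differentiating \<open>exp (l v) = v - z0\<close> determines the derivative of the branch.\<close>
      have "deriv (\<lambda>v. exp (l v)) u = deriv (\<lambda>v. v - z0) u"
        using elim(2) by (intro deriv_cong_ev refl) (auto elim: eventually_mono)
      moreover have "deriv (\<lambda>v. exp (l v)) u = exp (l u) * deriv l u"
        by (intro DERIV_imp_deriv) (auto intro!: derivative_eq_intros dl)
      moreover have "deriv (\<lambda>v. v - z0) u = 1"
        by (intro DERIV_imp_deriv) (auto intro!: derivative_eq_intros)
      ultimately have "(u - z0) * deriv l u = 1" "u - z0 \<noteq> 0"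
        using ul exp_not_eq_zero[of "l u"] by auto
      then have l': "deriv l u = 1 / (u - z0)"
        by (simp add: eq_divide_eq mult.commute)
      have "deriv w u = deriv (\<lambda>v. exp (\<kappa> * l v)) u"
        using elim(2) by (intro deriv_cong_ev refl) (auto elim: eventually_mono)
      also have "\<dots> = exp (\<kappa> * l u) * (\<kappa> * deriv l u)"
        by (intro DERIV_imp_deriv) (auto intro!: derivative_eq_intros dl)
      finally show ?case by (simp add: l' uw)
    qed
    have "(\<lambda>u. exp (\<kappa> * l u)) analytic_on {z}"
      using l by (intro analytic_intros)
    moreover have "\<forall>\<^sub>F u in nhds z. w u = exp (\<kappa> * l u)"
      using lw by eventually_elim simp
    ultimately have "w analytic_on {z}"
      using analytic_at_cong[of w "\<lambda>u. exp (\<kappa> * l u)" z z] by simp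
    moreover have "w z \<noteq> 0"
      using eventually_nhds_x_imp_x[OF lw] by simp
    ultimately have "w analytic_on {z}" "w z \<noteq> 0" by auto
    from diffop_sandwich[OF this(1) an[OF z] f ev] \<open>w z \<noteq> 0\<close>
    show "diffop \<sigma> (\<lambda>z. \<tau> z + 2 * \<sigma> z * ?h z)
        (\<lambda>z. \<eta> z + \<tau> z * ?h z + \<sigma> z * ((?h z)\<^sup>2 + deriv ?h z)) f z
        = inverse (w z) * diffop \<sigma> \<tau> \<eta> (\<lambda>u. w u * f u) z"
      by simp
  qed simp
  then show ?thesis
    unfolding sandwichable_def using an by (meson finite.emptyI finite_insert)
qed

lemma sandwichable_pole: "sandwichable (\<lambda>z. \<kappa> / (z - z0) ^ Suc n)"
proof (cases n)
  case 0
  then show ?thesis using sandwichable_simple_pole by simp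
next
  case (Suc m)
  let ?c = "- \<kappa> / of_nat (Suc m)"
  show ?thesis
  proof (rule sandwichable_exp[of "{z0}" _ "\<lambda>z. ?c / (z - z0) ^ Suc m"])
    fix z assume "z \<notin> {z0}"
    then have z: "z - z0 \<noteq> 0" by simp
    have "((\<lambda>z. (z - z0) ^ Suc m) has_field_derivative of_nat (Suc m) * (z - z0) ^ m) (at z)"
      using DERIV_power[OF DERIV_diff[OF DERIV_ident DERIV_const], where n = "Suc m"]
      by (simp del: power_Suc of_nat_Suc)
    from DERIV_imp_deriv[OF DERIV_divide[OF DERIV_const[of ?c] this]] z
    have "deriv (\<lambda>z. ?c / (z - z0) ^ Suc m) z
        = (0 * (z - z0) ^ Suc m - ?c * (of_nat (Suc m) * (z - z0) ^ m))
          / ((z - z0) ^ Suc m * (z - z0) ^ Suc m)"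
      by simp
    also have "?c * (of_nat (Suc m) * (z - z0) ^ m) = - \<kappa> * (z - z0) ^ m"
      by (simp del: of_nat_Suc)
    also have "(0 * (z - z0) ^ Suc m - - \<kappa> * (z - z0) ^ m) / ((z - z0) ^ Suc m * (z - z0) ^ Suc m)
        = \<kappa> / (z - z0) ^ Suc n"
      using z unfolding Suc by (simp add: divide_simps)
    finally show "deriv (\<lambda>z. ?c / (z - z0) ^ Suc m) z = \<kappa> / (z - z0) ^ Suc n" .
  next
    show "allowed_step A B" if "B \<approx> exp_sandwich (\<lambda>z. ?c / (z - z0) ^ Suc m) A" for A B
      by (rule allowed_step.exp_finite[OF _ that]) simp
  qed (auto intro!: analytic_intros simp del: of_nat_Suc)
qed

text \<open>
  The rational functions, in the form in which the allowed sandwiches produce them. The last rule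
  discards finitely many points, as equality of operators does.
\<close>
inductive partial_fraction :: "(complex \<Rightarrow> complex) \<Rightarrow> bool" where
  monomial: "partial_fraction (\<lambda>z. \<kappa> * z ^ n)"
| pole: "partial_fraction (\<lambda>z. \<kappa> / (z - z0) ^ Suc n)"
| add: "partial_fraction f \<Longrightarrow> partial_fraction g \<Longrightarrow> partial_fraction (\<lambda>z. f z + g z)"
| cong: "partial_fraction f \<Longrightarrow> finite S \<Longrightarrow> (\<And>z. z \<notin> S \<Longrightarrow> f z = g z) \<Longrightarrow> partial_fraction g"

lemma partial_fraction_sandwichable: "partial_fraction h \<Longrightarrow> sandwichable h"
proof (induction rule: partial_fraction.induct)
  case (cong f S g)
  then show ?case by (intro sandwichable_cong[of f S g])
qed (rule sandwichable_monomial sandwichable_pole sandwichable_add; assumption?)+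

text \<open>
  This is the step that adds one linear factor to a denominator. It rests on
  \<open>z / (z - b) = 1 + b / (z - b)\<close> and
  \<open>1 / ((z - a) (z - b)) = (1 / (z - a) - 1 / (z - b)) / (a - b)\<close>, each of which lowers an exponent.
\<close>
lemma partial_fraction_divide_linear:
  "partial_fraction h \<Longrightarrow> partial_fraction (\<lambda>z. h z / (z - b))"
proof (induction rule: partial_fraction.induct)
  case (monomial \<kappa> n)
  show ?case
  proof (induction n arbitrary: \<kappa>)
    case 0
    show ?case using partial_fraction.pole[of \<kappa> b 0] by simp
  next
    case (Suc n)
    show ?case
      by (rule partial_fraction.cong[OF
            partial_fraction.add[OF partial_fraction.monomial[of \<kappa> n] Suc[of "b * \<kappa>"]], of "{b}"])
        (auto simp: field_simps)
  qed
next
  case (pole \<kappa> a n)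
  show ?case
  proof (cases "a = b")
    case True
    then show ?thesis using partial_fraction.pole[of \<kappa> b "Suc n"] by (simp add: field_simps)
  next
    case False
    show ?thesis
    proof (induction n arbitrary: \<kappa>)
      case 0
      show ?case
        by (rule partial_fraction.cong[OF partial_fraction.add[OF
              partial_fraction.pole[of "\<kappa> / (a - b)" a 0]
              partial_fraction.pole[of "- \<kappa> / (a - b)" b 0]], of "{a, b}"])
          (use False in \<open>auto simp: divide_simps, auto simp: algebra_simps\<close>)
    next
      case (Suc n)
      show ?case
        by (rule partial_fraction.cong[OF partial_fraction.add[OF
              partial_fraction.pole[of "\<kappa> / (a - b)" a "Suc n"]
              Suc[of "- \<kappa> / (a - b)"]], of "{a, b}"])
          (use False in \<open>auto simp: divide_simps, auto simp: algebra_simps\<close>)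
    qed
  qed
next
  case (add f g)
  then show ?case using partial_fraction.add by (simp add: add_divide_distrib)
next
  case (cong f S g)
  then show ?case by (intro partial_fraction.cong[OF cong.IH cong.hyps(2)]) auto
qed

lemma partial_fraction_poly: "partial_fraction (poly p)"
proof -
  have "partial_fraction (\<lambda>z. z ^ m * poly p z)" for m
  proof (induction p arbitrary: m)
    case 0
    show ?case using partial_fraction.monomial[of 0 0] by simp
  next
    case (pCons a p)
    show ?case
      using partial_fraction.add[OF partial_fraction.monomial[of a m] pCons.IH[of "Suc m"]]
      by (simp add: algebra_simps)
  qed
  from this[of 0] show ?thesis by simp
qed

lemma partial_fraction_rational:
  fixes p q :: "complex poly"
  assumes "q \<noteq> 0"
  shows "partial_fraction (\<lambda>z. poly p z / poly q z)"
proof -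
  obtain R where q: "q = smult (lead_coeff q) (\<Prod>x\<in>#R. [:- x, 1:])"
    using alg_closed_imp_factorization[OF assms] by blast
  have "partial_fraction (\<lambda>z. poly p' z / poly (\<Prod>x\<in>#R. [:- x, 1:]) z)" for p'
  proof (induction R)
    case empty
    show ?case using partial_fraction_poly by simp
  next
    case (add b R)
    show ?case
      using partial_fraction_divide_linear[OF add, of b] by (simp add: algebra_simps)
  qed
  from this[of "smult (1 / lead_coeff q) p"] show ?thesis
    by (subst q) (simp add: divide_inverse algebra_simps)
qed

text \<open>
  For \<open>h = p / \<sigma>\<close> the new \<open>\<tau>\<close> is again a polynomial, and the denominators \<open>\<sigma>\<^sup>2\<close> of \<open>h\<^sup>2 + h'\<close> are
  reduced to \<open>\<sigma>\<close> by the factor \<open>\<sigma>\<close> in front, so that the class of operators is preserved.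
\<close>
lemma poly_op_sandwich:
  assumes "\<sigma> \<noteq> 0"
  shows "poly_op \<sigma> \<tau> \<xi>
    \<leadsto> poly_op \<sigma> (\<tau> + smult 2 p) (\<xi> + \<tau> * p + p\<^sup>2 + pderiv p * \<sigma> - p * pderiv \<sigma>)"
proof -
  let ?h = "\<lambda>z. poly p z / poly \<sigma> z"
  have "sandwichable ?h"
    using assms by (intro partial_fraction_sandwichable partial_fraction_rational)
  then have tr: "diffop s t e \<leadsto> diffop s (\<lambda>z. t z + 2 * s z * ?h z)
      (\<lambda>z. e z + t z * ?h z + s z * ((?h z)\<^sup>2 + deriv ?h z))" for s t e
    unfolding sandwichable_def by simp
  have 1: "poly_op \<sigma> \<tau> \<xi> \<leadsto> diffop (poly \<sigma>) (\<lambda>z. poly \<tau> z + 2 * poly \<sigma> z * ?h z)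
      (\<lambda>z. poly \<xi> z / poly \<sigma> z + poly \<tau> z * ?h z + poly \<sigma> z * ((?h z)\<^sup>2 + deriv ?h z))"
    unfolding poly_op_def by (rule tr)
  have 2: "diffop (poly \<sigma>) (\<lambda>z. poly \<tau> z + 2 * poly \<sigma> z * ?h z)
      (\<lambda>z. poly \<xi> z / poly \<sigma> z + poly \<tau> z * ?h z + poly \<sigma> z * ((?h z)\<^sup>2 + deriv ?h z))
    \<leadsto> poly_op \<sigma> (\<tau> + smult 2 p) (\<xi> + \<tau> * p + p\<^sup>2 + pderiv p * \<sigma> - p * pderiv \<sigma>)"
    unfolding poly_op_def
  proof (rule op_eq_step, rule diffop_op_eqI[of "{z. poly \<sigma> z = 0}"])
    show "finite {z. poly \<sigma> z = 0}"
      using assms by (rule poly_roots_finite)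
  next
    fix z assume "z \<notin> {z. poly \<sigma> z = 0}"
    then have z: "poly \<sigma> z \<noteq> 0" by simp
    have dv: "deriv ?h z
        = (poly (pderiv p) z * poly \<sigma> z - poly p z * poly (pderiv \<sigma>) z) / (poly \<sigma> z)\<^sup>2"
      using DERIV_imp_deriv[OF DERIV_divide[OF poly_DERIV poly_DERIV z]]
      by (simp add: power2_eq_square)
    show "poly \<xi> z / poly \<sigma> z + poly \<tau> z * ?h z + poly \<sigma> z * ((?h z)\<^sup>2 + deriv ?h z)
        = poly (\<xi> + \<tau> * p + p\<^sup>2 + pderiv p * \<sigma> - p * pderiv \<sigma>) z / poly \<sigma> z"
    proof -
      have c: "poly \<sigma> z * (N / (poly \<sigma> z)\<^sup>2) = N / poly \<sigma> z" for N
        using z by (simp add: power2_eq_square)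
      show ?thesis
        unfolding dv power_divide add_divide_distrib[symmetric] c
        by (simp add: add_divide_distrib diff_divide_distrib)
    qed
  qed auto
  show ?thesis by (rule rtranclp_trans[OF 1 2])
qed

section \<open>Affine changes of variable\<close>

lemma diffop_affine:
  assumes a: "a \<noteq> 0" and k: "k \<noteq> 0"
  shows "diffop \<sigma> \<tau> \<eta> \<leadsto> diffop (\<lambda>z. \<sigma> (a * z + b) / (a\<^sup>2 * k))
    (\<lambda>z. \<tau> (a * z + b) / (a * k)) (\<lambda>z. \<eta> (a * z + b) / k)"
proof -
  let ?B = "diffop (\<lambda>z. \<sigma> (a * z + b) / a\<^sup>2) (\<lambda>z. \<tau> (a * z + b) / a) (\<lambda>z. \<eta> (a * z + b))"
  have chain: "deriv (\<lambda>w. g ((w - b) / a)) w = deriv g ((w - b) / a) / a"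
    if "g analytic_on {(w - b) / a}" for g w
  proof -
    have "((\<lambda>w. g ((w - b) / a)) has_field_derivative deriv g ((w - b) / a) * (1 / a)) (at w)"
      using a by (intro DERIV_chain'[of "\<lambda>w. (w - b) / a"] analytic_at_has_deriv that)
        (auto intro!: derivative_eq_intros)
    then show ?thesis using DERIV_imp_deriv by simp
  qed
  have "?B \<approx> affine_change a b (diffop \<sigma> \<tau> \<eta>)"
    unfolding op_eq_def
  proof (intro exI[of _ "{}"] conjI allI impI)
    fix z f assume f: "f analytic_on {z}"
    have z: "(a * z + b - b) / a = z" using a by simp
    have "((\<lambda>w. (w - b) / a) \<longlongrightarrow> (a * z + b - b) / a) (nhds (a * z + b))"
      using a by (intro tendsto_intros) (auto simp: filterlim_ident)
    then have "filterlim (\<lambda>w. (w - b) / a) (nhds z) (nhds (a * z + b))"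
      using z by simp
    from eventually_compose_filterlim[OF eventually_analytic_nhds[OF f] this]
    have "\<forall>\<^sub>F w in nhds (a * z + b). f analytic_on {(w - b) / a}" .
    then have ev: "\<forall>\<^sub>F w in nhds (a * z + b).
        deriv (\<lambda>w. f ((w - b) / a)) w = deriv f ((w - b) / a) / a"
      by eventually_elim (rule chain)
    have "deriv (deriv (\<lambda>w. f ((w - b) / a))) (a * z + b)
        = deriv (\<lambda>w. deriv f ((w - b) / a) / a) (a * z + b)"
      by (rule deriv_cong_ev[OF ev refl])
    also have "\<dots> = deriv (deriv f) z / a / a"
    proof -
      have f': "deriv f analytic_on {z}" using f by (rule analytic_deriv)
      have "((\<lambda>w. deriv f ((w - b) / a)) has_field_derivative deriv (deriv f) z * (1 / a))
          (at (a * z + b))"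
        using a analytic_at_has_deriv[OF f']
        by (intro DERIV_chain'[of "\<lambda>w. (w - b) / a"]) (auto intro!: derivative_eq_intros)
      from DERIV_imp_deriv[OF DERIV_cdivide[OF this, of a]] show ?thesis by simp
    qed
    finally show "?B f z = affine_change a b (diffop \<sigma> \<tau> \<eta>) f z"
      using eventually_nhds_x_imp_x[OF ev] a
      by (simp add: affine_change_def diffop_def power2_eq_square)
  qed simp
  then have 1: "diffop \<sigma> \<tau> \<eta> \<leadsto> ?B"
    using a by (intro r_into_rtranclp allowed_step.affine)
  have 2: "?B \<leadsto> diffop (\<lambda>z. \<sigma> (a * z + b) / (a\<^sup>2 * k))
    (\<lambda>z. \<tau> (a * z + b) / (a * k)) (\<lambda>z. \<eta> (a * z + b) / k)"
    by (intro r_into_rtranclp allowed_step.divide[of k] k, unfold op_eq_def, intro exI[of _ "{}"])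
      (auto simp: diffop_def add_divide_distrib)
  show ?thesis by (rule rtranclp_trans[OF 1 2])
qed

section \<open>The reduction to coefficients\<close>

text \<open>
  The conclusion to be proved, as a property of an operator. It may be proved for any transform of
  the operator, which is what makes successive normalizations possible. The type \<open>T\<close> is chosen before
  \<open>v\<close> and \<open>c\<close>, so the case distinctions that lead to it must precede those on \<open>v\<close>.
\<close>
definition classified :: "operator \<Rightarrow> bool" where
  "classified A \<longleftrightarrow> (\<exists>B. A \<leadsto> B \<and> riemann_class B)
    \<or> (\<exists>T. \<forall>v c. c \<noteq> 0 \<longrightarrow> (\<exists>B. A \<leadsto> B \<and> normal_form v c T B))
    \<or> (\<exists>B. A \<leadsto> B \<and> z_times_riemann B)"

lemma classified_if_transforms:
  assumes "A \<leadsto> A'" "classified A'"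
  shows "classified A"
  using assms(2) rtranclp_trans[OF assms(1)] unfolding classified_def by meson

lemma classified_normal_formI:
  assumes "\<And>v c. c \<noteq> 0 \<Longrightarrow> \<exists>B. A \<leadsto> B \<and> normal_form v c T B"
  shows "classified A"
  using assms unfolding classified_def by blast

lemma classified_riemannI:
  assumes "\<sigma> \<noteq> 0" "degree \<sigma> \<le> 2" "degree \<tau> \<le> 1" "degree \<xi> \<le> 2"
  shows "classified (poly_op \<sigma> \<tau> \<xi>)"
  using assms unfolding classified_def riemann_class_def by blast

lemma classified_z_times_riemannI:
  assumes "\<sigma> \<noteq> 0" "degree \<sigma> \<le> 2" "degree \<tau> \<le> 1" "degree \<xi> \<le> 2"
    and "poly \<sigma> 0 = 0" "degree \<sigma> = 2 \<or> degree \<tau> = 1 \<and> degree \<xi> \<le> 1"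
  shows "classified (poly_op (pCons 0 \<sigma>) (pCons 0 \<tau>) (pCons 0 (pCons 0 \<xi>)))"
proof -
  let ?B = "\<lambda>f z. z * poly_op \<sigma> \<tau> \<xi> f z"
  have "z_times_riemann ?B"
    unfolding z_times_riemann_def using assms by blast
  moreover have "poly_op (pCons 0 \<sigma>) (pCons 0 \<tau>) (pCons 0 (pCons 0 \<xi>)) \<leadsto> ?B"
  proof (rule op_eq_step, unfold op_eq_def, intro exI[of _ "{0}"] conjI allI impI)
    fix z :: complex and f
    assume "z \<notin> {0}"
    then show "poly_op (pCons 0 \<sigma>) (pCons 0 \<tau>) (pCons 0 (pCons 0 \<xi>)) f z = ?B f z"
      by (simp add: poly_op_def diffop_def algebra_simps)
  qed simp
  ultimately show ?thesis unfolding classified_def by blast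
qed

text \<open>
  The premises are oriented so that a desired value, such as 0, can be prescribed for each new
  coefficient \<open>y\<close>; where the value does not matter, \<open>y\<close> is left to be instantiated. Coefficient
  lists are padded with zeros to a fixed length, so that one formula serves for all \<open>\<sigma>\<close>.
\<close>
lemma sandwich_coefficients:
  assumes "[:s0, s1, s2, s3:] \<noteq> 0"
    and "x0 + t0 * p0 + p0\<^sup>2 + p1 * s0 - p0 * s1 = y0"
    and "x1 + t0 * p1 + t1 * p0 + 2 * p0 * p1 + 2 * p2 * s0 - 2 * p0 * s2 = y1"
    and "x2 + t0 * p2 + t1 * p1 + t2 * p0 + 2 * p0 * p2 + p1\<^sup>2
      + p2 * s1 - p1 * s2 - 3 * p0 * s3 = y2"
    and "x3 + t1 * p2 + t2 * p1 + 2 * p1 * p2 - 2 * p1 * s3 = y3"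
    and "x4 + t2 * p2 + p2\<^sup>2 - p2 * s3 = y4"
  shows "poly_op [:s0, s1, s2, s3:] [:t0, t1, t2:] [:x0, x1, x2, x3, x4:]
    \<leadsto> poly_op [:s0, s1, s2, s3:] [:t0 + 2 * p0, t1 + 2 * p1, t2 + 2 * p2:] [:y0, y1, y2, y3, y4:]"
proof -
  let ?s = "[:s0, s1, s2, s3:]" and ?t = "[:t0, t1, t2:]" and ?x = "[:x0, x1, x2, x3, x4:]"
    and ?p = "[:p0, p1, p2:]"
  have "?t + smult 2 ?p = [:t0 + 2 * p0, t1 + 2 * p1, t2 + 2 * p2:]"
    by simp
  moreover have "?x + ?t * ?p + ?p\<^sup>2 + pderiv ?p * ?s - ?p * pderiv ?s = [:y0, y1, y2, y3, y4:]"
    by (rule poly_eq_poly_eq_iff[THEN iffD1], rule ext)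
      (simp add: pderiv_pCons assms(2-6)[symmetric] power2_eq_square algebra_simps)
  ultimately show ?thesis
    using poly_op_sandwich[OF assms(1), of ?t ?x ?p] by simp
qed

text \<open>
  The equations avoid division: the new \<open>\<eta>\<close> is called \<open>e\<close>, and it enters through the polynomial
  \<open>\<xi> = \<sigma> \<eta>\<close>. Under \<open>z \<mapsto> a z + b\<close> and division by \<open>k\<close>, \<open>\<sigma>\<close> scales by \<open>1 / (a\<^sup>2 k)\<close> and \<open>\<eta>\<close> by \<open>1 / k\<close>.
\<close>
lemma poly_op_affine_diffop:
  assumes a: "a \<noteq> 0" and k: "k \<noteq> 0" and S: "finite S"
    and s: "\<And>z. z \<notin> S \<Longrightarrow> s z \<noteq> 0"
    and eq: "\<And>z. z \<notin> S \<Longrightarrow> poly \<sigma> (a * z + b) = a\<^sup>2 * k * s z"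
      "\<And>z. z \<notin> S \<Longrightarrow> poly \<tau> (a * z + b) = a * k * t z"
      "\<And>z. z \<notin> S \<Longrightarrow> poly \<xi> (a * z + b) = (a * k)\<^sup>2 * (s z * e z)"
  shows "poly_op \<sigma> \<tau> \<xi> \<leadsto> diffop s t e"
  unfolding poly_op_def
proof (rule rtranclp_trans[OF diffop_affine[OF a k, of _ _ _ b] op_eq_step], rule diffop_op_eqI[OF S])
  fix z assume z: "z \<notin> S"
  show "poly \<sigma> (a * z + b) / (a\<^sup>2 * k) = s z" "poly \<tau> (a * z + b) / (a * k) = t z"
    using a k by (simp_all add: eq z)
  show "poly \<xi> (a * z + b) / poly \<sigma> (a * z + b) / k = e z"
    using a k s[OF z] by (simp add: eq z power2_eq_square)
qed

lemma normal_form_reached: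
  assumes "A \<leadsto> poly_op \<sigma> \<tau> \<xi>" "normal_form v c T (diffop s t e)"
    and "a \<noteq> 0" "k \<noteq> 0" "finite S" "\<And>z. z \<notin> S \<Longrightarrow> s z \<noteq> 0"
    and "\<And>z. z \<notin> S \<Longrightarrow> poly \<sigma> (a * z + b) = a\<^sup>2 * k * s z"
      "\<And>z. z \<notin> S \<Longrightarrow> poly \<tau> (a * z + b) = a * k * t z"
      "\<And>z. z \<notin> S \<Longrightarrow> poly \<xi> (a * z + b) = (a * k)\<^sup>2 * (s z * e z)"
  shows "\<exists>B. A \<leadsto> B \<and> normal_form v c T B"
  using rtranclp_trans[OF assms(1) poly_op_affine_diffop[OF assms(3-9)]] assms(2) by blast

lemma classified_affineI:
  assumes a: "a \<noteq> 0" and k: "k \<noteq> 0"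
    and \<sigma>: "\<sigma> \<noteq> 0" "pcompose \<sigma> [:b, a:] = smult (a\<^sup>2 * k) \<sigma>'"
    and cl: "\<And>\<tau> \<xi>. degree \<tau> \<le> 2 \<Longrightarrow> degree \<xi> \<le> 4 \<Longrightarrow> classified (poly_op \<sigma>' \<tau> \<xi>)"
    and deg: "degree \<tau> \<le> 2" "degree \<xi> \<le> 4"
  shows "classified (poly_op \<sigma> \<tau> \<xi>)"
proof (rule classified_if_transforms)
  let ?t = "smult (1 / (a * k)) (pcompose \<tau> [:b, a:])"
    and ?x = "smult (1 / (a * k)\<^sup>2) (pcompose \<xi> [:b, a:])"
  show "classified (poly_op \<sigma>' ?t ?x)"
    using deg a by (intro cl) (auto simp: degree_pcompose intro: order.trans[OF degree_smult_le])
  have \<sigma>': "\<sigma>' \<noteq> 0"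
    using \<sigma> a by (auto simp: pcompose_eq_0_iff)
  have l: "poly [:b, a:] z = a * z + b" for z by simp
  have p\<sigma>: "poly \<sigma> (a * z + b) = a\<^sup>2 * k * poly \<sigma>' z" for z
    using arg_cong[OF \<sigma>(2), of "\<lambda>p. poly p z"] by (simp add: poly_pcompose l del: poly_pCons)
  show "poly_op \<sigma> \<tau> \<xi> \<leadsto> poly_op \<sigma>' ?t ?x"
    unfolding poly_op_def[of \<sigma>']
    by (rule poly_op_affine_diffop[OF a k poly_roots_finite[OF \<sigma>'], where b = b])
      (use a k in \<open>auto simp: p\<sigma> poly_pcompose l simp del: poly_pCons\<close>)
qed

lemma ex_quadratic_root: "\<exists>p::complex. x + t * p + p\<^sup>2 = 0"
proof
  define r where "r = csqrt (t\<^sup>2 / 4 - x)"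
  have "r\<^sup>2 = t\<^sup>2 / 4 - x" by (simp add: r_def)
  then show "x + t * (r - t / 2) + (r - t / 2)\<^sup>2 = 0"
    by (simp add: power2_eq_square algebra_simps)
qed

lemma ex_linear_root:
  fixes d :: complex
  assumes "d \<noteq> 0"
  shows "\<exists>p. x + d * p = 0"
  using assms by (intro exI[of _ "- x / d"]) simp

text \<open>By \<open>(t + 2 p)\<^sup>2 = t\<^sup>2 - 4 x\<close>.\<close>
lemma quadratic_root_simple:
  fixes p :: complex
  assumes "x + t * p + p\<^sup>2 = 0" "t\<^sup>2 \<noteq> 4 * x"
  shows "t + 2 * p \<noteq> 0"
proof
  assume "t + 2 * p = 0"
  then have "t = - 2 * p" by (simp add: eq_neg_iff_add_eq_0)
  then have "t\<^sup>2 = 4 * p\<^sup>2" "p\<^sup>2 = x" using assms(1) by (auto simp: power2_eq_square)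
  then show False using assms(2) by simp
qed

lemma ex_nth_root:
  fixes w :: complex
  assumes "w \<noteq> 0" "n > 0"
  shows "\<exists>a. a \<noteq> 0 \<and> a ^ n = w"
proof (intro exI[of _ "exp (Ln w / of_nat n)"] conjI)
  show "exp (Ln w / of_nat n) ^ n = w"
    using assms by (simp flip: exp_of_nat_mult)
qed simp

text \<open>
  If the discriminant at infinity or at the multiple zero vanishes, the extreme coefficients of \<open>\<tau>\<close>
  and \<open>\<xi>\<close> can be removed together, because the quadratic equation for \<open>p0\<close> or \<open>p2\<close> then has the
  double root \<open>- t0 / 2\<close> or \<open>- t2 / 2\<close>.
\<close>
lemma ramified_at_infinity:
  assumes "[:s0, s1, s2, 0:] \<noteq> 0" "t2\<^sup>2 = 4 * x4"
  shows "\<exists>y0 y1 y2 y3. poly_op [:s0, s1, s2, 0:] [:t0, t1, t2:] [:x0, x1, x2, x3, x4:]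
    \<leadsto> poly_op [:s0, s1, s2, 0:] [:t0, t1, 0:] [:y0, y1, y2, y3, 0:]"
proof -
  define p2 where "p2 = - t2 / 2"
  have t2: "t2 = - 2 * p2" and x4: "x4 = p2\<^sup>2"
    using assms(2) by (auto simp: p2_def power2_eq_square)
  have "\<exists>y0 y1 y2 y3. poly_op [:s0, s1, s2, 0:] [:t0, t1, t2:] [:x0, x1, x2, x3, x4:]
      \<leadsto> poly_op [:s0, s1, s2, 0:] [:t0 + 2 * 0, t1 + 2 * 0, t2 + 2 * p2:] [:y0, y1, y2, y3, 0:]"
    by (intro exI, rule sandwich_coefficients[OF assms(1)], (rule refl)+) (use t2 x4 in algebra)
  then show ?thesis using t2 by simp
qed

lemma ramified_at_zero:
  assumes "[:0, 0, s2, s3:] \<noteq> 0" "t0\<^sup>2 = 4 * x0"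
  shows "\<exists>y1 y2 y3. poly_op [:0, 0, s2, s3:] [:t0, t1, t2:] [:x0, x1, x2, x3, x4:]
    \<leadsto> poly_op [:0, 0, s2, s3:] [:0, t1, t2:] [:0, y1, y2, y3, x4:]"
proof -
  define p0 where "p0 = - t0 / 2"
  have t0: "t0 = - 2 * p0" and x0: "x0 = p0\<^sup>2"
    using assms(2) by (auto simp: p0_def power2_eq_square)
  have "\<exists>y1 y2 y3. poly_op [:0, 0, s2, s3:] [:t0, t1, t2:] [:x0, x1, x2, x3, x4:]
      \<leadsto> poly_op [:0, 0, s2, s3:] [:t0 + 2 * p0, t1 + 2 * 0, t2 + 2 * 0:] [:0, y1, y2, y3, x4:]"
    by (intro exI, rule sandwich_coefficients[OF assms(1)], use t0 x0 in algebra, (rule refl)+)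
      simp
  then show ?thesis using t0 by simp
qed

lemma classified_riemann_coefficients:
  assumes "[:s0, s1, s2, 0:] \<noteq> 0"
  shows "classified (poly_op [:s0, s1, s2, 0:] [:t0, t1, 0:] [:x0, x1, x2, 0, 0:])"
  using assms by (intro classified_riemannI) auto

section \<open>Three simple zeros\<close>

text \<open>
  The quadratic equations prescribe \<open>p\<close> at the three zeros for form a; for form b the one at 0 is
  replaced by the one at infinity. Interpolation then determines \<open>p\<close>. The numbers \<open>q1\<close> and \<open>qt\<close> are
  the values of \<open>p\<close> at 1 and at \<open>t\<close>; in their equations, \<open>1 - t\<close> and \<open>t\<^sup>2 - t\<close> are the values of
  \<open>\<sigma>'\<close>.
\<close>
lemma classified_three_zeros:
  assumes "t \<noteq> 0" "t \<noteq> 1"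
  shows "classified (poly_op [:0, t, - (1 + t), 1:] [:t0, t1, t2:] [:x0, x1, x2, x3, x4:])"
    (is "classified ?A")
proof (rule classified_normal_formI[of _ T_u1_u1_u1__u1])
  fix v and c :: complex
  obtain q1 where q1: "x0 + x1 + x2 + x3 + x4 + (t0 + t1 + t2 - (1 - t)) * q1 + q1\<^sup>2 = 0"
    using ex_quadratic_root by blast
  obtain qt where qt: "x0 + x1 * t + x2 * t\<^sup>2 + x3 * t ^ 3 + x4 * t ^ 4
      + (t0 + t1 * t + t2 * t\<^sup>2 - (t\<^sup>2 - t)) * qt + qt\<^sup>2 = 0"
    using ex_quadratic_root by blast
  show "\<exists>B. ?A \<leadsto> B \<and> normal_form v c T_u1_u1_u1__u1 B"
  proof (cases v)
    case Form_a
    obtain p0 where p0: "x0 + (t0 - t) * p0 + p0\<^sup>2 = 0"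
      using ex_quadratic_root by blast
    define p2 where "p2 = ((qt - p0) / t - (q1 - p0)) / (t - 1)"
    define p1 where "p1 = q1 - p0 - p2"
    have p: "p0 + p1 + p2 = q1" "p0 + p1 * t + p2 * t\<^sup>2 = qt"
    proof -
      have "p2 * (t - 1) = (qt - p0) / t - (q1 - p0)"
        using assms by (simp add: p2_def)
      moreover have "t * ((qt - p0) / t) = qt - p0"
        using assms by simp
      ultimately show "p0 + p1 * t + p2 * t\<^sup>2 = qt"
        unfolding p1_def by algebra
    qed (simp add: p1_def)
    have "\<exists>y1 y2 y3 y4. ?A \<leadsto> poly_op [:0, t, - (1 + t), 1:]
        [:t0 + 2 * p0, t1 + 2 * p1, t2 + 2 * p2:] [:0, y1, y2, y3, y4:]
      \<and> y1 + y2 + y3 + y4 = 0 \<and> y1 * t + y2 * t\<^sup>2 + y3 * t ^ 3 + y4 * t ^ 4 = 0"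
      by (intro exI conjI, rule sandwich_coefficients, simp, use p0 in algebra, (rule refl)+)
        (use p0 p q1 qt in algebra)+
    then obtain y1 y2 y3 y4 where A: "?A \<leadsto> poly_op [:0, t, - (1 + t), 1:]
        [:t0 + 2 * p0, t1 + 2 * p1, t2 + 2 * p2:] [:0, y1, y2, y3, y4:]"
      and y: "y1 + y2 + y3 + y4 = 0" "t * (y1 + y2 * t + y3 * t\<^sup>2 + y4 * t ^ 3) = 0"
      by (auto simp: algebra_simps power2_eq_square power3_eq_cube power4_eq_xxxx)
    have "y1 + y2 * t + y3 * t\<^sup>2 + y4 * t ^ 3 = 0"
      using y(2) assms by simp
    then have "(t - 1) * (y2 + y3 * (t + 1) + y4 * (t\<^sup>2 + t + 1)) = 0"
      using y(1) by algebra
    then have "y2 + y3 * (t + 1) + y4 * (t\<^sup>2 + t + 1) = 0"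
      using assms by simp
    then have y2: "y2 = - (y3 * (t + 1) + y4 * (t\<^sup>2 + t + 1))"
      by algebra
    have y1: "y1 = y3 * t + y4 * (t\<^sup>2 + t)"
      using y(1) y2 by algebra
    show ?thesis
      by (rule normal_form_reached[OF A normal_form.intros(1)[OF assms, of v c
              "t2 + 2 * p2" "t1 + 2 * p1" "t0 + 2 * p0" "y3 + (1 + t) * y4" y4],
            of 1 1 "{0, 1, t}" 0];
          (simp; fail | simp add: Form_a y1 y2 algebra_simps power2_eq_square))
  next
    case Form_b
    obtain p2 where p2: "x4 + (t2 - 1) * p2 + p2\<^sup>2 = 0"
      using ex_quadratic_root by blast
    define p1 where "p1 = (qt - q1) / (t - 1) - p2 * (t + 1)"
    define p0 where "p0 = q1 - p1 - p2"
    have p: "p0 + p1 + p2 = q1" "p0 + p1 * t + p2 * t\<^sup>2 = qt"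
    proof -
      have "(p1 + p2 * (t + 1)) * (t - 1) = qt - q1"
        using assms by (simp add: p1_def)
      then show "p0 + p1 * t + p2 * t\<^sup>2 = qt"
        unfolding p0_def by algebra
    qed (simp add: p0_def)
    have "\<exists>y0 y1 y2 y3. ?A \<leadsto> poly_op [:0, t, - (1 + t), 1:]
        [:t0 + 2 * p0, t1 + 2 * p1, t2 + 2 * p2:] [:y0, y1, y2, y3, 0:]
      \<and> y0 + y1 + y2 + y3 = 0 \<and> y0 + y1 * t + y2 * t\<^sup>2 + y3 * t ^ 3 = 0"
      by (intro exI conjI, rule sandwich_coefficients, simp, (rule refl)+, use p2 in algebra)
        (use p2 p q1 qt in algebra)+
    then obtain y0 y1 y2 y3 where A: "?A \<leadsto> poly_op [:0, t, - (1 + t), 1:]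
        [:t0 + 2 * p0, t1 + 2 * p1, t2 + 2 * p2:] [:y0, y1, y2, y3, 0:]"
      and y: "y0 + y1 + y2 + y3 = 0" "y0 + y1 * t + y2 * t\<^sup>2 + y3 * t ^ 3 = 0"
      by auto
    have "(t - 1) * (y1 + y2 * (t + 1) + y3 * (t\<^sup>2 + t + 1)) = 0"
      using y by algebra
    then have "y1 + y2 * (t + 1) + y3 * (t\<^sup>2 + t + 1) = 0"
      using assms by simp
    then have y1: "y1 = - (y2 * (t + 1) + y3 * (t\<^sup>2 + t + 1))"
      by algebra
    have y0: "y0 = y2 * t + y3 * (t\<^sup>2 + t)"
      using y(1) y1 by algebra
    show ?thesis
      by (rule normal_form_reached[OF A normal_form.intros(1)[OF assms, of v c
              "t2 + 2 * p2" "t1 + 2 * p1" "t0 + 2 * p0" y3 "y2 + (1 + t) * y3"],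
            of 1 1 "{0, 1, t}" 0];
          (simp; fail | simp add: Form_b y0 y1 field_simps power2_eq_square))
  qed
qed

section \<open>A double and a simple zero\<close>

text \<open>
  Once \<open>p0\<close> is a root, the coefficient of \<open>z\<close> in \<open>\<xi>\<close> is linear in \<open>p1\<close> with nonzero slope
  \<open>t0 + 2 p0\<close>; form a uses \<open>p1\<close> to remove it. The value \<open>q\<close> of \<open>p\<close> at the simple zero 1 makes \<open>\<xi>\<close>
  vanish there.
\<close>
lemma classified_double_simple_rank_2:
  assumes "t0\<^sup>2 \<noteq> 4 * x0"
  shows "classified (poly_op [:0, 0, - 1, 1:] [:t0, t1, t2:] [:x0, x1, x2, x3, x4:])"
    (is "classified ?A")
proof (rule classified_normal_formI[of _ T_2_u1__u1])
  fix v and c :: complex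
  obtain p0 where p0: "x0 + t0 * p0 + p0\<^sup>2 = 0"
    using ex_quadratic_root by blast
  have a0: "t0 + 2 * p0 \<noteq> 0"
    using p0 assms by (rule quadratic_root_simple)
  obtain q where q: "x0 + x1 + x2 + x3 + x4 + (t0 + t1 + t2 - 1) * q + q\<^sup>2 = 0"
    using ex_quadratic_root by blast
  show "\<exists>B. ?A \<leadsto> B \<and> normal_form v c T_2_u1__u1 B"
  proof (cases v)
    case Form_a
    obtain p1 where p1: "(x1 + t1 * p0 + 2 * p0) + (t0 + 2 * p0) * p1 = 0"
      using ex_linear_root[OF a0] by blast
    define p2 where "p2 = q - p0 - p1"
    have "\<exists>y2 y3 y4. ?A \<leadsto> poly_op [:0, 0, - 1, 1:]
        [:t0 + 2 * p0, t1 + 2 * p1, t2 + 2 * p2:] [:0, 0, y2, y3, y4:] \<and> y2 + y3 + y4 = 0"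
      by (intro exI conjI, rule sandwich_coefficients, simp, use p0 in algebra, use p1 in algebra,
          (rule refl)+) (use p0 p1 p2_def q in algebra)
    then obtain y2 y3 y4 where A: "?A \<leadsto> poly_op [:0, 0, - 1, 1:]
        [:t0 + 2 * p0, t1 + 2 * p1, t2 + 2 * p2:] [:0, 0, y2, y3, y4:]"
      and y: "y2 + y3 + y4 = 0"
      by auto
    have y2: "y2 = - (y3 + y4)"
      using y by algebra
    show ?thesis
      by (rule normal_form_reached[OF A normal_form.intros(3)[OF a0, of v c
              "t2 + 2 * p2" "t1 + 2 * p1" "y3 + y4" y4], of 1 1 "{0, 1}" 0];
          (simp; fail | simp add: Form_a y2 algebra_simps power2_eq_square))
  next
    case Form_b
    obtain p2 where p2: "x4 + (t2 - 1) * p2 + p2\<^sup>2 = 0"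
      using ex_quadratic_root by blast
    define p1 where "p1 = q - p0 - p2"
    have "\<exists>y1 y2 y3. ?A \<leadsto> poly_op [:0, 0, - 1, 1:]
        [:t0 + 2 * p0, t1 + 2 * p1, t2 + 2 * p2:] [:0, y1, y2, y3, 0:] \<and> y1 + y2 + y3 = 0"
      by (intro exI conjI, rule sandwich_coefficients, simp, use p0 in algebra,
          (rule refl)+, use p2 in algebra) (use p0 p1_def p2 q in algebra)
    then obtain y1 y2 y3 where A: "?A \<leadsto> poly_op [:0, 0, - 1, 1:]
        [:t0 + 2 * p0, t1 + 2 * p1, t2 + 2 * p2:] [:0, y1, y2, y3, 0:]"
      and y: "y1 + y2 + y3 = 0"
      by auto
    have y2: "y2 = - (y1 + y3)"
      using y by algebra
    show ?thesis
      by (rule normal_form_reached[OF A normal_form.intros(3)[OF a0, of v c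
              "t2 + 2 * p2" "t1 + 2 * p1" y3 "- y1"], of 1 1 "{0, 1}" 0];
          (simp; fail | simp add: Form_b y2 field_simps power2_eq_square))
  qed
qed

text \<open>
  With \<open>t0 = p0 = 0\<close> the coefficient \<open>x1\<close> does not change, and \<open>p1\<close>, \<open>p2\<close> are free for the conditions
  at 1 and at infinity. The sign of \<open>- x1\<close> comes from \<open>\<sigma> = z\<^sup>2 (z - 1)\<close>.
\<close>
lemma classified_double_simple_rank_3_2:
  assumes "x1 \<noteq> 0"
  shows "classified (poly_op [:0, 0, - 1, 1:] [:0, t1, t2:] [:0, x1, x2, x3, x4:])"
    (is "classified ?A")
proof (rule classified_normal_formI[of _ T_3h_u1__u1])
  fix v and c :: complex
  obtain q where q: "x1 + x2 + x3 + x4 + (t1 + t2 - 1) * q + q\<^sup>2 = 0"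
    using ex_quadratic_root by blast
  obtain p2 where p2: "x4 + (t2 - 1) * p2 + p2\<^sup>2 = 0"
    using ex_quadratic_root by blast
  define p1 where "p1 = q - p2"
  have "\<exists>y2 y3. ?A \<leadsto> poly_op [:0, 0, - 1, 1:]
      [:0 + 2 * 0, t1 + 2 * p1, t2 + 2 * p2:] [:0, x1, y2, y3, 0:] \<and> x1 + y2 + y3 = 0"
    by (intro exI conjI, rule sandwich_coefficients, simp, simp, simp,
        (rule refl)+, use p2 in algebra) (use p1_def p2 q in algebra)
  then obtain y2 y3 where A: "?A \<leadsto> poly_op [:0, 0, - 1, 1:]
      [:0 + 2 * 0, t1 + 2 * p1, t2 + 2 * p2:] [:0, x1, y2, y3, 0:]"
    and y: "x1 + y2 + y3 = 0"
    by auto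
  have y2: "y2 = - (x1 + y3)"
    using y by algebra
  have bm1: "- x1 \<noteq> 0" using assms by simp
  show "\<exists>B. ?A \<leadsto> B \<and> normal_form v c T_3h_u1__u1 B"
    by (rule normal_form_reached[OF A normal_form.intros(5)[OF bm1, of v c
            "t2 + 2 * p2" "t1 + 2 * p1" y3], of 1 1 "{0, 1}" 0];
        (simp; fail | simp add: y2 field_simps power2_eq_square))
qed

lemma classified_double_simple:
  "classified (poly_op [:0, 0, - 1, 1:] [:t0, t1, t2:] [:x0, x1, x2, x3, x4:])"
proof (cases "t0\<^sup>2 = 4 * x0")
  case False
  then show ?thesis by (rule classified_double_simple_rank_2)
next
  case True
  have "[:0, 0, - 1, 1:] \<noteq> (0 :: complex poly)" by simp
  from ramified_at_zero[OF this True] obtain y1 y2 y3 where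
    A: "poly_op [:0, 0, - 1, 1:] [:t0, t1, t2:] [:x0, x1, x2, x3, x4:]
      \<leadsto> poly_op [:0, 0, - 1, 1:] [:0, t1, t2:] [:0, y1, y2, y3, x4:]" by blast
  have "classified (poly_op [:0, 0, - 1, 1:] [:0, t1, t2:] [:0, y1, y2, y3, x4:])"
  proof (cases "y1 = 0")
    case False
    then show ?thesis by (rule classified_double_simple_rank_3_2)
  next
    case True
    show ?thesis
      unfolding True by (rule classified_z_times_riemannI) auto
  qed
  with A show ?thesis by (rule classified_if_transforms)
qed

section \<open>A triple zero\<close>

text \<open>
  The conditions on \<open>p0\<close>, \<open>p1\<close>, \<open>p2\<close> are solved in this order; only the last differs between the two
  forms. Scaling by \<open>a\<close> and division by \<open>k = a\<close> keep \<open>\<sigma> = z\<^sup>3\<close> and divide \<open>t0 + 2 p0\<close> by \<open>a\<^sup>2\<close>.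
\<close>
lemma classified_triple_rank_3:
  assumes "t0\<^sup>2 \<noteq> 4 * x0"
  shows "classified (poly_op [:0, 0, 0, 1:] [:t0, t1, t2:] [:x0, x1, x2, x3, x4:])"
    (is "classified ?A")
proof (rule classified_normal_formI[of _ T_3__u1])
  fix v and c :: complex
  assume c: "c \<noteq> 0"
  obtain p0 where p0: "x0 + t0 * p0 + p0\<^sup>2 = 0"
    using ex_quadratic_root by blast
  have a0: "t0 + 2 * p0 \<noteq> 0"
    using p0 assms by (rule quadratic_root_simple)
  obtain p1 where p1: "(x1 + t1 * p0) + (t0 + 2 * p0) * p1 = 0"
    using ex_linear_root[OF a0] by blast
  obtain a where a: "a \<noteq> 0" "a\<^sup>2 = (t0 + 2 * p0) / c"
    using ex_nth_root[of "(t0 + 2 * p0) / c" 2] a0 c by auto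
  have A0: "t0 + 2 * p0 = c * a\<^sup>2"
    using a c by simp
  show "\<exists>B. ?A \<leadsto> B \<and> normal_form v c T_3__u1 B"
  proof (cases v)
    case Form_a
    obtain p2 where p2: "(x2 + t1 * p1 + t2 * p0 + p1\<^sup>2 - 3 * p0) + (t0 + 2 * p0) * p2 = 0"
      using ex_linear_root[OF a0] by blast
    have "\<exists>y3 y4. ?A \<leadsto> poly_op [:0, 0, 0, 1:]
        [:t0 + 2 * p0, t1 + 2 * p1, t2 + 2 * p2:] [:0, 0, 0, y3, y4:]"
      by (intro exI, rule sandwich_coefficients, simp, use p0 in algebra, use p1 in algebra,
          use p2 in algebra) (rule refl)+
    then obtain y3 y4 where A: "?A \<leadsto> poly_op [:0, 0, 0, 1:]
        [:c * a\<^sup>2, t1 + 2 * p1, t2 + 2 * p2:] [:0, 0, 0, y3, y4:]"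
      unfolding A0 by auto
    show ?thesis
      by (rule normal_form_reached[OF A normal_form.intros(13)[OF refl, of v c
              "t2 + 2 * p2" "(t1 + 2 * p1) / a" "y3 / a" y4], of a a "{0}" 0];
          (simp add: a; fail | simp add: Form_a a(1) field_simps power2_eq_square power3_eq_cube))
  next
    case Form_b
    obtain p2 where p2: "x4 + (t2 - 1) * p2 + p2\<^sup>2 = 0"
      using ex_quadratic_root by blast
    have "\<exists>y2 y3. ?A \<leadsto> poly_op [:0, 0, 0, 1:]
        [:t0 + 2 * p0, t1 + 2 * p1, t2 + 2 * p2:] [:0, 0, y2, y3, 0:]"
      by (intro exI, rule sandwich_coefficients, simp, use p0 in algebra, use p1 in algebra,
          (rule refl)+) (use p2 in algebra)
    then obtain y2 y3 where A: "?A \<leadsto> poly_op [:0, 0, 0, 1:]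
        [:c * a\<^sup>2, t1 + 2 * p1, t2 + 2 * p2:] [:0, 0, y2, y3, 0:]"
      unfolding A0 by auto
    show ?thesis
      by (rule normal_form_reached[OF A normal_form.intros(13)[OF refl, of v c
              "t2 + 2 * p2" "(t1 + 2 * p1) / a" "y3 / a" "y2 / a\<^sup>2"], of a a "{0}" 0];
          (simp add: a; fail | simp add: Form_b a(1) field_simps power2_eq_square power3_eq_cube))
  qed
qed

lemma classified_triple_rank_5_2:
  assumes "x1 \<noteq> 0"
  shows "classified (poly_op [:0, 0, 0, 1:] [:0, t1, t2:] [:0, x1, x2, x3, x4:])"
    (is "classified ?A")
proof (rule classified_normal_formI[of _ T_5h__u1])
  fix v and c :: complex
  assume c: "c \<noteq> 0"
  define p1 where "p1 = - t1 / 2"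
  have t1: "t1 = - 2 * p1" by (simp add: p1_def)
  obtain p2 where p2: "x4 + (t2 - 1) * p2 + p2\<^sup>2 = 0"
    using ex_quadratic_root by blast
  obtain a where a: "a \<noteq> 0" "a ^ 3 = x1 / c"
    using ex_nth_root[of "x1 / c" 3] assms c by auto
  have x1: "x1 = c * a ^ 3"
    using a c by simp
  have "\<exists>y2 y3. ?A \<leadsto> poly_op [:0, 0, 0, 1:]
      [:0 + 2 * 0, t1 + 2 * p1, t2 + 2 * p2:] [:0, x1, y2, y3, 0:]"
    by (intro exI, rule sandwich_coefficients, simp, simp, simp, (rule refl)+)
      (use p2 in algebra)
  then obtain y2 y3 where A: "?A \<leadsto> poly_op [:0, 0, 0, 1:]
      [:0, 0, t2 + 2 * p2:] [:0, c * a ^ 3, y2, y3, 0:]"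
    using t1 x1 by auto
  show "\<exists>B. ?A \<leadsto> B \<and> normal_form v c T_5h__u1 B"
    by (rule normal_form_reached[OF A normal_form.intros(15)[OF refl, of v c
            "t2 + 2 * p2" "y3 / a" "y2 / a\<^sup>2"], of a a "{0}" 0];
        (simp add: a; fail | simp add: a(1) field_simps power2_eq_square power3_eq_cube))
qed

lemma classified_triple:
  "classified (poly_op [:0, 0, 0, 1:] [:t0, t1, t2:] [:x0, x1, x2, x3, x4:])"
proof (cases "t0\<^sup>2 = 4 * x0")
  case False
  then show ?thesis by (rule classified_triple_rank_3)
next
  case True
  have "[:0, 0, 0, 1:] \<noteq> (0 :: complex poly)" by simp
  from ramified_at_zero[OF this True] obtain y1 y2 y3 where
    A: "poly_op [:0, 0, 0, 1:] [:t0, t1, t2:] [:x0, x1, x2, x3, x4:]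
      \<leadsto> poly_op [:0, 0, 0, 1:] [:0, t1, t2:] [:0, y1, y2, y3, x4:]" by blast
  have "classified (poly_op [:0, 0, 0, 1:] [:0, t1, t2:] [:0, y1, y2, y3, x4:])"
  proof (cases "y1 = 0")
    case False
    then show ?thesis by (rule classified_triple_rank_5_2)
  next
    case True
    show ?thesis
      unfolding True by (rule classified_z_times_riemannI) auto
  qed
  with A show ?thesis by (rule classified_if_transforms)
qed

section \<open>Two simple zeros\<close>

text \<open>
  Here the discriminant concerns infinity: after \<open>p2\<close>, form b removes the coefficient of \<open>z\<^sup>3\<close> by
  the linear equation for \<open>p1\<close>, whereas form a removes the value at 0.
\<close>
lemma classified_two_simple_rank_2:
  assumes "t2\<^sup>2 \<noteq> 4 * x4"
  shows "classified (poly_op [:0, - 1, 1, 0:] [:t0, t1, t2:] [:x0, x1, x2, x3, x4:])"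
    (is "classified ?A")
proof (rule classified_normal_formI[of _ T_u1_u1__2])
  fix v and c :: complex
  obtain p2 where p2: "x4 + t2 * p2 + p2\<^sup>2 = 0"
    using ex_quadratic_root by blast
  have a2: "t2 + 2 * p2 \<noteq> 0"
    using p2 assms by (rule quadratic_root_simple)
  obtain q where q: "x0 + x1 + x2 + x3 + x4 + (t0 + t1 + t2 - 1) * q + q\<^sup>2 = 0"
    using ex_quadratic_root by blast
  show "\<exists>B. ?A \<leadsto> B \<and> normal_form v c T_u1_u1__2 B"
  proof (cases v)
    case Form_a
    obtain p0 where p0: "x0 + (t0 + 1) * p0 + p0\<^sup>2 = 0"
      using ex_quadratic_root by blast
    define p1 where "p1 = q - p0 - p2"
    have "\<exists>y1 y2 y3. ?A \<leadsto> poly_op [:0, - 1, 1, 0:]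
        [:t0 + 2 * p0, t1 + 2 * p1, t2 + 2 * p2:] [:0, y1, y2, y3, 0:] \<and> y1 + y2 + y3 = 0"
      by (intro exI conjI, rule sandwich_coefficients, simp, use p0 in algebra,
          (rule refl)+, use p2 in algebra) (use p0 p1_def p2 q in algebra)
    then obtain y1 y2 y3 where A: "?A \<leadsto> poly_op [:0, - 1, 1, 0:]
        [:t0 + 2 * p0, t1 + 2 * p1, t2 + 2 * p2:] [:0, y1, y2, y3, 0:]"
      and y: "y1 + y2 + y3 = 0"
      by auto
    have y2: "y2 = - (y1 + y3)"
      using y by algebra
    show ?thesis
      by (rule normal_form_reached[OF A normal_form.intros(2)[OF a2, of v c
              "t1 + 2 * p1" "t0 + 2 * p0" "- y1" y3], of 1 1 "{0, 1}" 0];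
          (simp; fail | simp add: Form_a y2 algebra_simps power2_eq_square))
  next
    case Form_b
    obtain p1 where p1: "(x3 + t1 * p2) + (t2 + 2 * p2) * p1 = 0"
      using ex_linear_root[OF a2] by blast
    define p0 where "p0 = q - p1 - p2"
    have "\<exists>y0 y1 y2. ?A \<leadsto> poly_op [:0, - 1, 1, 0:]
        [:t0 + 2 * p0, t1 + 2 * p1, t2 + 2 * p2:] [:y0, y1, y2, 0, 0:] \<and> y0 + y1 + y2 = 0"
      by (intro exI conjI, rule sandwich_coefficients, simp, (rule refl)+, use p1 in algebra,
          use p2 in algebra) (use p0_def p1 p2 q in algebra)
    then obtain y0 y1 y2 where A: "?A \<leadsto> poly_op [:0, - 1, 1, 0:]
        [:t0 + 2 * p0, t1 + 2 * p1, t2 + 2 * p2:] [:y0, y1, y2, 0, 0:]"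
      and y: "y0 + y1 + y2 = 0"
      by auto
    have y1: "y1 = - (y0 + y2)"
      using y by algebra
    show ?thesis
      by (rule normal_form_reached[OF A normal_form.intros(2)[OF a2, of v c
              "t1 + 2 * p1" "t0 + 2 * p0" y2 "- y0"], of 1 1 "{0, 1}" 0];
          (simp; fail | simp add: Form_b y1 field_simps power2_eq_square))
  qed
qed

lemma classified_two_simple_rank_3_2:
  assumes "x3 \<noteq> 0"
  shows "classified (poly_op [:0, - 1, 1, 0:] [:t0, t1, 0:] [:x0, x1, x2, x3, 0:])"
    (is "classified ?A")
proof (rule classified_normal_formI[of _ T_u1_u1__3h])
  fix v and c :: complex
  obtain q where q: "x0 + x1 + x2 + x3 + (t0 + t1 - 1) * q + q\<^sup>2 = 0"
    using ex_quadratic_root by blast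
  obtain p0 where p0: "x0 + (t0 + 1) * p0 + p0\<^sup>2 = 0"
    using ex_quadratic_root by blast
  define p1 where "p1 = q - p0"
  have "\<exists>y1 y2. ?A \<leadsto> poly_op [:0, - 1, 1, 0:]
      [:t0 + 2 * p0, t1 + 2 * p1, 0 + 2 * 0:] [:0, y1, y2, x3, 0:] \<and> y1 + y2 + x3 = 0"
    by (intro exI conjI, rule sandwich_coefficients, simp, use p0 in algebra,
        (rule refl)+, simp, simp) (use p0 p1_def q in algebra)
  then obtain y1 y2 where A: "?A \<leadsto> poly_op [:0, - 1, 1, 0:]
      [:t0 + 2 * p0, t1 + 2 * p1, 0 + 2 * 0:] [:0, y1, y2, x3, 0:]"
    and y: "y1 + y2 + x3 = 0"
    by auto
  have y2: "y2 = - (y1 + x3)"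
    using y by algebra
  show "\<exists>B. ?A \<leadsto> B \<and> normal_form v c T_u1_u1__3h B"
    by (rule normal_form_reached[OF A normal_form.intros(4)[OF assms, of v c
            "t1 + 2 * p1" "t0 + 2 * p0" "- y1"], of 1 1 "{0, 1}" 0];
        (simp; fail | simp add: y2 algebra_simps power2_eq_square))
qed

lemma classified_two_simple:
  "classified (poly_op [:0, - 1, 1, 0:] [:t0, t1, t2:] [:x0, x1, x2, x3, x4:])"
    (is "classified ?A")
proof (cases "t2\<^sup>2 = 4 * x4")
  case False
  then show ?thesis by (rule classified_two_simple_rank_2)
next
  case True
  have "[:0, - 1, 1, 0:] \<noteq> (0 :: complex poly)" by simp
  from ramified_at_infinity[OF this True] obtain y0 y1 y2 y3 where
    A: "?A \<leadsto> poly_op [:0, - 1, 1, 0:] [:t0, t1, 0:] [:y0, y1, y2, y3, 0:]" by blast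
  have "classified (poly_op [:0, - 1, 1, 0:] [:t0, t1, 0:] [:y0, y1, y2, y3, 0:])"
    using classified_two_simple_rank_3_2 classified_riemann_coefficients[of 0 "- 1" 1]
    by (cases "y3 = 0") auto
  with A show ?thesis by (rule classified_if_transforms)
qed

section \<open>A double zero\<close>

text \<open>
  Both ends are unramified and prescribe \<open>p0\<close> and \<open>p2\<close>. The coefficient \<open>p1\<close> is left to remove
  either the coefficient of \<open>z\<close> in \<open>\<xi>\<close>, form a, or that of \<open>z\<^sup>3\<close>, form b. A scaling keeps \<open>\<sigma> = z\<^sup>2\<close>
  without any division.
\<close>
lemma classified_double_rank_2_2:
  assumes "t0\<^sup>2 \<noteq> 4 * x0" "t2\<^sup>2 \<noteq> 4 * x4"
  shows "classified (poly_op [:0, 0, 1, 0:] [:t0, t1, t2:] [:x0, x1, x2, x3, x4:])"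
    (is "classified ?A")
proof (rule classified_normal_formI[of _ T_2__2])
  fix v and c :: complex
  assume c: "c \<noteq> 0"
  obtain p0 where p0: "x0 + t0 * p0 + p0\<^sup>2 = 0"
    using ex_quadratic_root by blast
  have a0: "t0 + 2 * p0 \<noteq> 0"
    using p0 assms(1) by (rule quadratic_root_simple)
  obtain p2 where p2: "x4 + t2 * p2 + p2\<^sup>2 = 0"
    using ex_quadratic_root by blast
  have a2: "t2 + 2 * p2 \<noteq> 0"
    using p2 assms(2) by (rule quadratic_root_simple)
  define a where "a = (t0 + 2 * p0) / c"
  have a: "a \<noteq> 0" and A0: "t0 + 2 * p0 = c * a"
    using a0 c by (simp_all add: a_def)
  have a2a: "(t2 + 2 * p2) * a \<noteq> 0"
    using a a2 by simp
  show "\<exists>B. ?A \<leadsto> B \<and> normal_form v c T_2__2 B"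
  proof (cases v)
    case Form_a
    obtain p1 where p1: "(x1 + t1 * p0 - 2 * p0) + (t0 + 2 * p0) * p1 = 0"
      using ex_linear_root[OF a0] by blast
    have "\<exists>y2 y3. ?A \<leadsto> poly_op [:0, 0, 1, 0:]
        [:t0 + 2 * p0, t1 + 2 * p1, t2 + 2 * p2:] [:0, 0, y2, y3, 0:]"
      by (intro exI, rule sandwich_coefficients, simp, use p0 in algebra, use p1 in algebra,
          (rule refl)+) (use p2 in algebra)
    then obtain y2 y3 where A: "?A \<leadsto> poly_op [:0, 0, 1, 0:]
        [:c * a, t1 + 2 * p1, t2 + 2 * p2:] [:0, 0, y2, y3, 0:]"
      unfolding A0 by auto
    show ?thesis
      by (rule normal_form_reached[OF A normal_form.intros(6)[OF a2a refl, of v c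
              "t1 + 2 * p1" y2 "a * y3"], of a 1 "{0}" 0];
          (simp add: a; fail | simp add: Form_a algebra_simps power2_eq_square))
  next
    case Form_b
    obtain p1 where p1: "(x3 + t1 * p2) + (t2 + 2 * p2) * p1 = 0"
      using ex_linear_root[OF a2] by blast
    have "\<exists>y1 y2. ?A \<leadsto> poly_op [:0, 0, 1, 0:]
        [:t0 + 2 * p0, t1 + 2 * p1, t2 + 2 * p2:] [:0, y1, y2, 0, 0:]"
      by (intro exI, rule sandwich_coefficients, simp, use p0 in algebra,
          (rule refl)+, use p1 in algebra) (use p2 in algebra)
    then obtain y1 y2 where A: "?A \<leadsto> poly_op [:0, 0, 1, 0:]
        [:c * a, t1 + 2 * p1, t2 + 2 * p2:] [:0, y1, y2, 0, 0:]"
      unfolding A0 by auto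
    show ?thesis
      by (rule normal_form_reached[OF A normal_form.intros(6)[OF a2a refl, of v c
              "t1 + 2 * p1" y2 "y1 / a"], of a 1 "{0}" 0];
          (simp add: a; fail | simp add: Form_b a field_simps power2_eq_square))
  qed
qed

lemma classified_double_rank_3_2_2:
  assumes "x1 \<noteq> 0" "t2\<^sup>2 \<noteq> 4 * x4"
  shows "classified (poly_op [:0, 0, 1, 0:] [:0, t1, t2:] [:0, x1, x2, x3, x4:])"
    (is "classified ?A")
proof (rule classified_normal_formI[of _ T_3h__2])
  fix v and c :: complex
  assume c: "c \<noteq> 0"
  obtain p2 where p2: "x4 + t2 * p2 + p2\<^sup>2 = 0"
    using ex_quadratic_root by blast
  have a2: "t2 + 2 * p2 \<noteq> 0"
    using p2 assms(2) by (rule quadratic_root_simple)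
  obtain p1 where p1: "(x3 + t1 * p2) + (t2 + 2 * p2) * p1 = 0"
    using ex_linear_root[OF a2] by blast
  define a where "a = c / (t2 + 2 * p2)"
  have a: "a \<noteq> 0" and A2: "t2 + 2 * p2 = c / a"
    using a2 c by (simp_all add: a_def)
  have "\<exists>y2. ?A \<leadsto> poly_op [:0, 0, 1, 0:]
      [:0 + 2 * 0, t1 + 2 * p1, t2 + 2 * p2:] [:0, x1, y2, 0, 0:]"
    by (intro exI, rule sandwich_coefficients, simp, simp, simp,
        (rule refl)+, use p1 in algebra) (use p2 in algebra)
  then obtain y2 where A: "?A \<leadsto> poly_op [:0, 0, 1, 0:]
      [:0 + 2 * 0, t1 + 2 * p1, c / a:] [:0, x1, y2, 0, 0:]"
    unfolding A2 by auto
  have bm1: "x1 / a \<noteq> 0"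
    using a assms(1) by simp
  show "\<exists>B. ?A \<leadsto> B \<and> normal_form v c T_3h__2 B"
    by (rule normal_form_reached[OF A normal_form.intros(7)[OF bm1 refl, of v c
            "t1 + 2 * p1" y2], of a 1 "{0}" 0];
        (simp add: a; fail | simp add: a field_simps power2_eq_square))
qed

lemma classified_double_rank_2_3_2:
  assumes "t0\<^sup>2 \<noteq> 4 * x0" "x3 \<noteq> 0"
  shows "classified (poly_op [:0, 0, 1, 0:] [:t0, t1, 0:] [:x0, x1, x2, x3, 0:])"
    (is "classified ?A")
proof (rule classified_normal_formI[of _ T_2__3h])
  fix v and c :: complex
  assume c: "c \<noteq> 0"
  obtain p0 where p0: "x0 + t0 * p0 + p0\<^sup>2 = 0"
    using ex_quadratic_root by blast
  have a0: "t0 + 2 * p0 \<noteq> 0"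
    using p0 assms(1) by (rule quadratic_root_simple)
  obtain p1 where p1: "(x1 + t1 * p0 - 2 * p0) + (t0 + 2 * p0) * p1 = 0"
    using ex_linear_root[OF a0] by blast
  define a where "a = (t0 + 2 * p0) / c"
  have a: "a \<noteq> 0" and A0: "t0 + 2 * p0 = c * a"
    using a0 c by (simp_all add: a_def)
  have "\<exists>y2. ?A \<leadsto> poly_op [:0, 0, 1, 0:]
      [:t0 + 2 * p0, t1 + 2 * p1, 0 + 2 * 0:] [:0, 0, y2, x3, 0:]"
    by (intro exI, rule sandwich_coefficients, simp, use p0 in algebra, use p1 in algebra,
        (rule refl)+) simp_all
  then obtain y2 where A: "?A \<leadsto> poly_op [:0, 0, 1, 0:]
      [:c * a, t1 + 2 * p1, 0 + 2 * 0:] [:0, 0, y2, x3, 0:]"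
    unfolding A0 by auto
  have b1: "a * x3 \<noteq> 0"
    using a assms(2) by simp
  show "\<exists>B. ?A \<leadsto> B \<and> normal_form v c T_2__3h B"
    by (rule normal_form_reached[OF A normal_form.intros(8)[OF b1 refl, of v c
            "t1 + 2 * p1" y2], of a 1 "{0}" 0];
        (simp add: a; fail | simp add: a algebra_simps power2_eq_square))
qed

lemma classified_double_rank_3_2_3_2:
  assumes "x1 \<noteq> 0" "x3 \<noteq> 0"
  shows "classified (poly_op [:0, 0, 1, 0:] [:0, t1, 0:] [:0, x1, x2, x3, 0:])"
    (is "classified ?A")
proof (rule classified_normal_formI[of _ T_3h__3h])
  fix v and c :: complex
  assume c: "c \<noteq> 0"
  define p1 where "p1 = - t1 / 2"
  define a where "a = c / x3"
  have t1: "t1 = - 2 * p1" and a: "a \<noteq> 0" and x3: "x3 = c / a"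
    using assms c by (simp_all add: a_def p1_def)
  have "\<exists>y2. ?A \<leadsto> poly_op [:0, 0, 1, 0:]
      [:0 + 2 * 0, t1 + 2 * p1, 0 + 2 * 0:] [:0, x1, y2, x3, 0:]"
    by (intro exI, rule sandwich_coefficients, simp, simp, simp, (rule refl)+) simp_all
  then obtain y2 where A: "?A \<leadsto> poly_op [:0, 0, 1, 0:] 0 [:0, x1, y2, c / a, 0:]"
    using t1 x3 by auto
  have bm1: "x1 / a \<noteq> 0"
    using a assms(1) by simp
  show "\<exists>B. ?A \<leadsto> B \<and> normal_form v c T_3h__3h B"
    by (rule normal_form_reached[OF A normal_form.intros(9)[OF bm1 refl, of v c y2],
          of a 1 "{0}" 0];
        (simp add: a; fail | simp add: a field_simps power2_eq_square))
qed

text \<open>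
  The equation of the operator has at 0 a regular singularity, and \<open>p1\<close> is one of its exponents:
  the equation for \<open>p1\<close> is the indicial equation.
\<close>
lemma classified_double_rank_1_3_2:
  assumes "x3 \<noteq> 0"
  shows "classified (poly_op [:0, 0, 1, 0:] [:0, t1, 0:] [:0, 0, x2, x3, 0:])"
    (is "classified ?A")
proof (rule classified_normal_formI[of _ T_1__3h])
  fix v and c :: complex
  assume c: "c \<noteq> 0"
  obtain p1 where p1: "x2 + (t1 - 1) * p1 + p1\<^sup>2 = 0"
    using ex_quadratic_root by blast
  define a where "a = c / x3"
  have a: "a \<noteq> 0" and x3: "x3 = c / a"
    using assms c by (simp_all add: a_def)
  have A: "?A \<leadsto> poly_op [:0, 0, 1, 0:]
      [:0 + 2 * 0, t1 + 2 * p1, 0 + 2 * 0:] [:0, 0, 0, c / a, 0:]"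
    by (rule sandwich_coefficients, simp, simp, simp, use p1 in algebra) (use x3 in simp_all)
  show "\<exists>B. ?A \<leadsto> B \<and> normal_form v c T_1__3h B"
    by (rule normal_form_reached[OF A normal_form.intros(10)[OF refl, of v c "t1 + 2 * p1"],
          of a 1 "{0}" 0];
        (simp add: a; fail | simp add: a field_simps power2_eq_square))
qed

text \<open>
  Degenerate at 0 and unramified at infinity. The transformation at infinity is needed for the
  degree conditions in \<^const>\<open>z_times_riemann\<close>: it makes the degree of \<open>\<tau> / z\<close> equal to 1 and that
  of \<open>\<xi> / z\<^sup>2\<close> at most 1.
\<close>
lemma classified_double_0_2:
  assumes "t2\<^sup>2 \<noteq> 4 * x4"
  shows "classified (poly_op [:0, 0, 1, 0:] [:0, t1, t2:] [:0, 0, x2, x3, x4:])"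
    (is "classified ?A")
proof -
  obtain p2 where p2: "x4 + t2 * p2 + p2\<^sup>2 = 0"
    using ex_quadratic_root by blast
  have a2: "t2 + 2 * p2 \<noteq> 0"
    using p2 assms by (rule quadratic_root_simple)
  have "\<exists>y2 y3. ?A \<leadsto> poly_op [:0, 0, 1, 0:]
      [:0 + 2 * 0, t1 + 2 * 0, t2 + 2 * p2:] [:0, 0, y2, y3, 0:]"
    by (intro exI, rule sandwich_coefficients, simp, simp, simp, (rule refl)+)
      (use p2 in algebra)
  then obtain y2 y3 where A: "?A \<leadsto> poly_op [:0, 0, 1, 0:]
      [:0, t1, t2 + 2 * p2:] [:0, 0, y2, y3, 0:]"
    by auto
  have "classified (poly_op [:0, 0, 1, 0:] [:0, t1, t2 + 2 * p2:] [:0, 0, y2, y3, 0:])"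
    by (rule classified_z_times_riemannI) (use a2 in auto)
  with A show ?thesis by (rule classified_if_transforms)
qed

lemma classified_double:
  "classified (poly_op [:0, 0, 1, 0:] [:t0, t1, t2:] [:x0, x1, x2, x3, x4:])"
proof -
  have nz: "[:0, 0, 1, 0:] \<noteq> (0 :: complex poly)" by simp
  have zero_ramified: "classified (poly_op [:0, 0, 1, 0:] [:0, t1, 0:] [:0, x1, x2, x3, 0:])"
    for t1 x1 x2 x3
    using classified_double_rank_3_2_3_2 classified_double_rank_1_3_2
      classified_riemann_coefficients[OF nz]
    by (cases "x3 = 0"; cases "x1 = 0") auto
  have infinity_ramified:
    "classified (poly_op [:0, 0, 1, 0:] [:t0, t1, 0:] [:x0, x1, x2, x3, 0:])"
    for t0 t1 x0 x1 x2 x3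
  proof (cases "t0\<^sup>2 = 4 * x0")
    case True
    then show ?thesis
      using ramified_at_zero[OF nz True] zero_ramified classified_if_transforms by blast
  next
    case False
    then show ?thesis
      using classified_double_rank_2_3_2 classified_riemann_coefficients[OF nz]
      by (cases "x3 = 0") auto
  qed
  have infinity_unramified:
    "classified (poly_op [:0, 0, 1, 0:] [:0, t1, t2:] [:0, x1, x2, x3, x4:])"
    if "t2\<^sup>2 \<noteq> 4 * x4" for t1 x1 x2 x3
    using that classified_double_rank_3_2_2 classified_double_0_2 by (cases "x1 = 0") auto
  show ?thesis
  proof (cases "t2\<^sup>2 = 4 * x4")
    case True
    then show ?thesis
      using ramified_at_infinity[OF nz True] infinity_ramified classified_if_transforms by blast
  next
    case False
    show ?thesis
    proof (cases "t0\<^sup>2 = 4 * x0")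
      case True
      then show ?thesis
        using ramified_at_zero[OF nz True] infinity_unramified[OF False] classified_if_transforms
        by blast
    next
      case 2: False
      show ?thesis using 2 False by (rule classified_double_rank_2_2)
    qed
  qed
qed

section \<open>A simple zero\<close>

text \<open>
  Infinity determines \<open>p2\<close> and \<open>p1\<close>. Form a then takes \<open>p0\<close> from the zero of \<open>\<sigma>\<close>, and form b from the
  linear equation that removes the coefficient of \<open>z\<^sup>2\<close>.
\<close>
lemma classified_simple_rank_3:
  assumes "t2\<^sup>2 \<noteq> 4 * x4"
  shows "classified (poly_op [:0, 1, 0, 0:] [:t0, t1, t2:] [:x0, x1, x2, x3, x4:])"
    (is "classified ?A")
proof (rule classified_normal_formI[of _ T_u1__3])
  fix v and c :: complex
  assume c: "c \<noteq> 0"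
  obtain p2 where p2: "x4 + t2 * p2 + p2\<^sup>2 = 0"
    using ex_quadratic_root by blast
  have a2: "t2 + 2 * p2 \<noteq> 0"
    using p2 assms by (rule quadratic_root_simple)
  obtain p1 where p1: "(x3 + t1 * p2) + (t2 + 2 * p2) * p1 = 0"
    using ex_linear_root[OF a2] by blast
  obtain a where a: "a \<noteq> 0" "a\<^sup>2 = c / (t2 + 2 * p2)"
    using ex_nth_root[of "c / (t2 + 2 * p2)" 2] a2 c by auto
  have A2: "t2 + 2 * p2 = c / a\<^sup>2"
    using a a2 c by (simp add: field_simps)
  show "\<exists>B. ?A \<leadsto> B \<and> normal_form v c T_u1__3 B"
  proof (cases v)
    case Form_a
    obtain p0 where p0: "x0 + (t0 - 1) * p0 + p0\<^sup>2 = 0"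
      using ex_quadratic_root by blast
    have "\<exists>y1 y2. ?A \<leadsto> poly_op [:0, 1, 0, 0:]
        [:t0 + 2 * p0, t1 + 2 * p1, t2 + 2 * p2:] [:0, y1, y2, 0, 0:]"
      by (intro exI, rule sandwich_coefficients, simp, use p0 in algebra, (rule refl)+)
        (use p1 p2 in algebra)+
    then obtain y1 y2 where A: "?A \<leadsto> poly_op [:0, 1, 0, 0:]
        [:t0 + 2 * p0, t1 + 2 * p1, c / a\<^sup>2:] [:0, y1, y2, 0, 0:]"
      unfolding A2 by auto
    show ?thesis
      by (rule normal_form_reached[OF A normal_form.intros(12)[OF refl, of v c
              "a * (t1 + 2 * p1)" "t0 + 2 * p0" "a * y1" "a\<^sup>2 * y2"], of a "1 / a" "{0}" 0];
          (simp add: a(1); fail | simp add: Form_a a(1) field_simps power2_eq_square))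
  next
    case Form_b
    obtain p0 where p0: "(x2 + t1 * p1 + t0 * p2 + p1\<^sup>2 + p2) + (t2 + 2 * p2) * p0 = 0"
      using ex_linear_root[OF a2] by blast
    have "\<exists>y0 y1. ?A \<leadsto> poly_op [:0, 1, 0, 0:]
        [:t0 + 2 * p0, t1 + 2 * p1, t2 + 2 * p2:] [:y0, y1, 0, 0, 0:]"
      by (intro exI, rule sandwich_coefficients, simp, (rule refl)+)
        (use p0 in algebra, use p1 in algebra, use p2 in algebra)
    then obtain y0 y1 where A: "?A \<leadsto> poly_op [:0, 1, 0, 0:]
        [:t0 + 2 * p0, t1 + 2 * p1, c / a\<^sup>2:] [:y0, y1, 0, 0, 0:]"
      unfolding A2 by auto
    show ?thesis
      by (rule normal_form_reached[OF A normal_form.intros(12)[OF refl, of v c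
              "a * (t1 + 2 * p1)" "t0 + 2 * p0" "a * y1" y0], of a "1 / a" "{0}" 0];
          (simp add: a(1); fail | simp add: Form_b a(1) field_simps power2_eq_square))
  qed
qed

lemma classified_simple_rank_5_2:
  assumes "x3 \<noteq> 0"
  shows "classified (poly_op [:0, 1, 0, 0:] [:t0, t1, 0:] [:x0, x1, x2, x3, 0:])"
    (is "classified ?A")
proof (rule classified_normal_formI[of _ T_u1__5h])
  fix v and c :: complex
  assume c: "c \<noteq> 0"
  define p1 where "p1 = - t1 / 2"
  have t1: "t1 = - 2 * p1" by (simp add: p1_def)
  obtain p0 where p0: "x0 + (t0 - 1) * p0 + p0\<^sup>2 = 0"
    using ex_quadratic_root by blast
  obtain a where a: "a \<noteq> 0" "a ^ 3 = c / x3"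
    using ex_nth_root[of "c / x3" 3] assms c by auto
  have x3: "x3 = c / a ^ 3"
    using a assms c by (simp add: field_simps)
  have "\<exists>y1 y2. ?A \<leadsto> poly_op [:0, 1, 0, 0:]
      [:t0 + 2 * p0, t1 + 2 * p1, 0 + 2 * 0:] [:0, y1, y2, x3, 0:]"
    by (intro exI, rule sandwich_coefficients, simp, use p0 in algebra, (rule refl)+) simp_all
  then obtain y1 y2 where A: "?A \<leadsto> poly_op [:0, 1, 0, 0:]
      [:t0 + 2 * p0, 0, 0:] [:0, y1, y2, c / a ^ 3, 0:]"
    using t1 x3 by auto
  show "\<exists>B. ?A \<leadsto> B \<and> normal_form v c T_u1__5h B"
    by (rule normal_form_reached[OF A normal_form.intros(14)[OF refl, of v c
            "t0 + 2 * p0" "a\<^sup>2 * y2" "a * y1"], of a "1 / a" "{0}" 0];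
        (simp add: a(1); fail | simp add: a(1) field_simps power2_eq_square power3_eq_cube))
qed

lemma classified_simple:
  "classified (poly_op [:0, 1, 0, 0:] [:t0, t1, t2:] [:x0, x1, x2, x3, x4:])"
    (is "classified ?A")
proof (cases "t2\<^sup>2 = 4 * x4")
  case False
  then show ?thesis by (rule classified_simple_rank_3)
next
  case True
  have "[:0, 1, 0, 0:] \<noteq> (0 :: complex poly)" by simp
  from ramified_at_infinity[OF this True] obtain y0 y1 y2 y3 where
    A: "?A \<leadsto> poly_op [:0, 1, 0, 0:] [:t0, t1, 0:] [:y0, y1, y2, y3, 0:]" by blast
  have "classified (poly_op [:0, 1, 0, 0:] [:t0, t1, 0:] [:y0, y1, y2, y3, 0:])"
    using classified_simple_rank_5_2 classified_riemann_coefficients[of 0 1 0]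
    by (cases "y3 = 0") auto
  with A show ?thesis by (rule classified_if_transforms)
qed

section \<open>A constant leading coefficient\<close>

text \<open>
  Without zeros of \<open>\<sigma>\<close> all of \<open>p\<close> is used at infinity, and removes the three leading coefficients of
  \<open>\<xi>\<close>. The middle coefficient of \<open>\<tau>\<close> can then only be removed by a shift.
\<close>
lemma classified_constant_rank_4:
  assumes "t2\<^sup>2 \<noteq> 4 * x4"
  shows "classified (poly_op [:1, 0, 0, 0:] [:t0, t1, t2:] [:x0, x1, x2, x3, x4:])"
    (is "classified ?A")
proof (rule classified_normal_formI[of _ T__4])
  fix v and c :: complex
  assume c: "c \<noteq> 0"
  obtain p2 where p2: "x4 + t2 * p2 + p2\<^sup>2 = 0"
    using ex_quadratic_root by blast
  have a2: "t2 + 2 * p2 \<noteq> 0"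
    using p2 assms by (rule quadratic_root_simple)
  obtain p1 where p1: "(x3 + t1 * p2) + (t2 + 2 * p2) * p1 = 0"
    using ex_linear_root[OF a2] by blast
  obtain p0 where p0: "(x2 + t1 * p1 + t0 * p2 + p1\<^sup>2) + (t2 + 2 * p2) * p0 = 0"
    using ex_linear_root[OF a2] by blast
  obtain a where a: "a \<noteq> 0" "a ^ 3 = c / (t2 + 2 * p2)"
    using ex_nth_root[of "c / (t2 + 2 * p2)" 3] a2 c by auto
  have A2: "t2 + 2 * p2 = c / a ^ 3"
    using a a2 c by (simp add: field_simps)
  \<comment> \<open>The shift that makes the sum of the two zeros of \<open>\<tau>\<close> vanish.\<close>
  obtain b where b: "(t1 + 2 * p1) + (2 * (t2 + 2 * p2)) * b = 0"
    using ex_linear_root a2 by (metis mult_eq_0_iff zero_neq_numeral)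
  then have A1: "t1 + 2 * p1 = - 2 * (c / a ^ 3) * b"
    unfolding A2 by algebra
  have "\<exists>y0 y1. ?A \<leadsto> poly_op [:1, 0, 0, 0:]
      [:t0 + 2 * p0, t1 + 2 * p1, t2 + 2 * p2:] [:y0, y1, 0, 0, 0:]"
    by (intro exI, rule sandwich_coefficients, simp, (rule refl)+)
      (use p0 in algebra, use p1 in algebra, use p2 in algebra)
  then obtain y0 y1 where A: "?A \<leadsto> poly_op [:1, 0, 0, 0:]
      [:t0 + 2 * p0, - 2 * (c / a ^ 3) * b, c / a ^ 3:] [:y0, y1, 0, 0, 0:]"
    unfolding A1 A2 by auto
  show "\<exists>B. ?A \<leadsto> B \<and> normal_form v c T__4 B"
    by (rule normal_form_reached[OF A normal_form.intros(16)[OF refl, of v c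
            "a * (t0 + 2 * p0 - c / a ^ 3 * b\<^sup>2)" "a ^ 3 * y1" "a\<^sup>2 * (y0 + y1 * b)"],
          of a "1 / a\<^sup>2" "{}" b];
        (simp add: a(1); fail | simp add: a(1) field_simps power2_eq_square power3_eq_cube))
qed

text \<open>
  Here \<open>\<tau>\<close> can be removed altogether, after which the shift is free to remove a coefficient of \<open>\<xi>\<close>.
\<close>
lemma classified_constant_rank_7_2:
  assumes "x3 \<noteq> 0"
  shows "classified (poly_op [:1, 0, 0, 0:] [:t0, t1, 0:] [:x0, x1, x2, x3, 0:])"
    (is "classified ?A")
proof (rule classified_normal_formI[of _ T__7h])
  fix v and c :: complex
  assume c: "c \<noteq> 0"
  define p0 p1 where "p0 = - t0 / 2" and "p1 = - t1 / 2"
  have t: "t0 = - 2 * p0" "t1 = - 2 * p1" by (simp_all add: p0_def p1_def)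
  obtain a where a: "a \<noteq> 0" "a ^ 5 = c / x3"
    using ex_nth_root[of "c / x3" 5] assms c by auto
  have x3: "x3 = c / a ^ 5"
    using a assms c by (simp add: field_simps)
  have "\<exists>y0 y1 y2. ?A \<leadsto> poly_op [:1, 0, 0, 0:]
      [:t0 + 2 * p0, t1 + 2 * p1, 0 + 2 * 0:] [:y0, y1, y2, x3, 0:]"
    by (intro exI, rule sandwich_coefficients, simp, (rule refl)+) simp_all
  then obtain y0 y1 y2 where A: "?A \<leadsto> poly_op [:1, 0, 0, 0:] 0 [:y0, y1, y2, x3, 0:]"
    using t by auto
  \<comment> \<open>The shift that makes the sum of the three zeros of \<open>\<eta>\<close> vanish.\<close>
  obtain b where b: "y2 + (3 * x3) * b = 0"
    using ex_linear_root[of "3 * x3"] assms by auto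
  then have y2: "y2 = - 3 * b * (c / a ^ 5)"
    unfolding x3 by algebra
  have A': "?A \<leadsto> poly_op [:1, 0, 0, 0:] 0 [:y0, y1, - 3 * b * (c / a ^ 5), c / a ^ 5, 0:]"
    using A unfolding y2 by (simp only: x3)
  show "\<exists>B. ?A \<leadsto> B \<and> normal_form v c T__7h B"
    by (rule normal_form_reached[OF A' normal_form.intros(17)[OF refl, of v c
            "a ^ 3 * (y1 - 3 * (c / a ^ 5) * b\<^sup>2)"
            "a\<^sup>2 * (y0 + y1 * b - 2 * (c / a ^ 5) * b ^ 3)"], of a "1 / a\<^sup>2" "{}" b];
        (simp add: a(1); fail
          | simp add: a(1) field_simps power2_eq_square power3_eq_cube eval_nat_numeral))
qed

lemma classified_constant:
  "classified (poly_op [:1, 0, 0, 0:] [:t0, t1, t2:] [:x0, x1, x2, x3, x4:])"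
    (is "classified ?A")
proof (cases "t2\<^sup>2 = 4 * x4")
  case False
  then show ?thesis by (rule classified_constant_rank_4)
next
  case True
  have "[:1, 0, 0, 0:] \<noteq> (0 :: complex poly)" by simp
  from ramified_at_infinity[OF this True] obtain y0 y1 y2 y3 where
    A: "?A \<leadsto> poly_op [:1, 0, 0, 0:] [:t0, t1, 0:] [:y0, y1, y2, y3, 0:]" by blast
  have "classified (poly_op [:1, 0, 0, 0:] [:t0, t1, 0:] [:y0, y1, y2, y3, 0:])"
    using classified_constant_rank_7_2 classified_riemann_coefficients[of 1 0 0]
    by (cases "y3 = 0") auto
  with A show ?thesis by (rule classified_if_transforms)
qed

section \<open>Normalization of the leading coefficient\<close>

lemma degree_le_Suc_pCons:
  assumes "degree p \<le> Suc n"
  obtains a q where "p = pCons a q" "degree q \<le> n"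
  using assms by (cases p) (auto simp: degree_pCons_eq_if split: if_splits)

lemma degree_le_2_coefficients:
  assumes "degree p \<le> 2"
  obtains t0 t1 t2 where "p = [:t0, t1, t2:]"
  using assms unfolding numeral_2_eq_2
  by (metis degree_le_Suc_pCons degree_0_id le_zero_eq)

lemma degree_le_4_coefficients:
  assumes "degree p \<le> 4"
  obtains x0 x1 x2 x3 x4 where "p = [:x0, x1, x2, x3, x4:]"
proof -
  have "degree p \<le> Suc (Suc 2)" using assms by simp
  then obtain x0 q where "p = pCons x0 q" "degree q \<le> Suc 2"
    by (rule degree_le_Suc_pCons)
  moreover from this(2) obtain x1 r where "q = pCons x1 r" "degree r \<le> 2"
    by (rule degree_le_Suc_pCons)
  moreover from this(2) obtain x2 x3 x4 where "r = [:x2, x3, x4:]"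
    by (rule degree_le_2_coefficients)
  ultimately show ?thesis using that by blast
qed

lemma classified_normalized:
  assumes "\<sigma> \<in> {[:1, 0, 0, 0:], [:0, 1, 0, 0:], [:0, 0, 1, 0:], [:0, - 1, 1, 0:],
      [:0, 0, 0, 1:], [:0, 0, - 1, 1:]} \<or> (\<exists>t. t \<noteq> 0 \<and> t \<noteq> 1 \<and> \<sigma> = [:0, t, - (1 + t), 1:])"
    and "degree \<tau> \<le> 2" "degree \<xi> \<le> 4"
  shows "classified (poly_op \<sigma> \<tau> \<xi>)"
proof -
  obtain t0 t1 t2 where \<tau>: "\<tau> = [:t0, t1, t2:]"
    using assms(2) by (rule degree_le_2_coefficients)
  obtain x0 x1 x2 x3 x4 where \<xi>: "\<xi> = [:x0, x1, x2, x3, x4:]"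
    using assms(3) by (rule degree_le_4_coefficients)
  show ?thesis
    unfolding \<tau> \<xi> using assms(1)
    by (elim disjE exE conjE insertE emptyE; hypsubst)
      (rule classified_constant classified_simple classified_double classified_two_simple
        classified_triple classified_double_simple classified_three_zeros; assumption)+
qed

text \<open>
  Two zeros can be moved to 0 and 1, which are then fixed; a third one becomes the parameter \<open>t\<close>.
  The leading coefficient is removed by the division.
\<close>
lemma classified_poly_op:
  assumes "\<sigma> \<noteq> 0" "degree \<sigma> \<le> 3" and deg: "degree \<tau> \<le> 2" "degree \<xi> \<le> 4"
  shows "classified (poly_op \<sigma> \<tau> \<xi>)"
proof -
  define k where "k = lead_coeff \<sigma>"
  have k: "k \<noteq> 0" using assms(1) by (simp add: k_def)
  obtain R where R: "size R = degree \<sigma>" and \<sigma>: "\<sigma> = smult k (\<Prod>x\<in>#R. [:- x, 1:])"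
    using alg_closed_imp_factorization[OF assms(1)] unfolding k_def by blast
  have double_simple: "classified (poly_op \<sigma> \<tau> \<xi>)"
    if "\<sigma> = smult k ([:- r, 1:] * ([:- r, 1:] * [:- s, 1:]))" "r \<noteq> s" for r s
  proof -
    define a where "a = s - r"
    have a: "a \<noteq> 0" and s: "s = r + a" using that(2) by (auto simp: a_def)
    show ?thesis
      by (rule classified_affineI[OF a _ assms(1) _ classified_normalized deg,
            of "k * a" r "[:0, 0, - 1, 1:]"])
        (use a k in \<open>simp_all add: that(1) s pcompose_smult pcompose_mult pcompose_pCons
            power2_eq_square algebra_simps\<close>)
  qed
  have size_1: "\<exists>r. N = {#r#}" if "size N = 1" for N :: "complex multiset"
    using that by (rule size_1_singleton_mset)
  have size_2: "\<exists>r s. N = {#r, s#}" if "size N = 2" for N :: "complex multiset"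
    using that size_1 size_eq_Suc_imp_eq_union[of N 1] by fastforce
  have size_3: "\<exists>r s u. N = {#r, s, u#}" if "size N = 3" for N :: "complex multiset"
    using that size_2 size_eq_Suc_imp_eq_union[of N 2] by fastforce
  consider "R = {#}" | r where "R = {#r#}" | r s where "R = {#r, s#}" | r s u where "R = {#r, s, u#}"
  proof -
    have "size R = 0 \<or> size R = 1 \<or> size R = 2 \<or> size R = 3"
      using R assms(2) by linarith
    then show ?thesis using that size_1 size_2 size_3 by (metis size_eq_0_iff_empty)
  qed
  then show ?thesis
  proof cases
    case 1
    then have "\<sigma> = [:k:]" using \<sigma> by simp
    then show ?thesis
      by (intro classified_affineI[OF _ k assms(1) _ classified_normalized deg,
            of 1 0 "[:1, 0, 0, 0:]"]) simp_all
  next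
    case 2
    then have "\<sigma> = smult k [:- r, 1:]"
      using \<sigma> by simp
    then show ?thesis
      by (intro classified_affineI[OF _ k assms(1) _ classified_normalized deg,
            of 1 r "[:0, 1, 0, 0:]"]) (simp_all add: pcompose_pCons)
  next
    case 3
    then have \<sigma>: "\<sigma> = smult k ([:- r, 1:] * [:- s, 1:])"
      using \<sigma> by simp
    show ?thesis
    proof (cases "r = s")
      case True
      show ?thesis
        by (rule classified_affineI[OF _ k assms(1) _ classified_normalized deg,
              of 1 r "[:0, 0, 1, 0:]"])
          (simp_all add: \<sigma> True pcompose_smult pcompose_mult pcompose_pCons)
    next
      case False
      define a where "a = s - r"
      have a: "a \<noteq> 0" and s: "s = r + a" using False by (auto simp: a_def)
      show ?thesis
        by (rule classified_affineI[OF a k assms(1) _ classified_normalized deg,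
              of r "[:0, - 1, 1, 0:]"])
          (simp_all add: \<sigma> s pcompose_smult pcompose_mult pcompose_pCons power2_eq_square
            algebra_simps)
    qed
  next
    case 4
    then have \<sigma>: "\<sigma> = smult k ([:- r, 1:] * ([:- s, 1:] * [:- u, 1:]))"
      using \<sigma> by simp
    consider "r = s" "s = u" | "r = s" "s \<noteq> u" | "r = u" "r \<noteq> s" | "s = u" "r \<noteq> s"
      | "r \<noteq> s" "r \<noteq> u" "s \<noteq> u" by blast
    then show ?thesis
    proof cases
      case 1
      show ?thesis
        by (rule classified_affineI[OF _ k assms(1) _ classified_normalized deg,
              of 1 r "[:0, 0, 0, 1:]"])
          (simp_all add: \<sigma> 1 pcompose_smult pcompose_mult pcompose_pCons)
    next
      case 2
      then show ?thesis using \<sigma> by (intro double_simple[of r u]) auto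
    next
      case 3
      have "\<sigma> = smult k ([:- u, 1:] * ([:- u, 1:] * [:- s, 1:]))"
        unfolding \<sigma> 3(1) by (simp only: mult_ac)
      from double_simple[OF this] show ?thesis using 3 by auto
    next
      case 4
      have "\<sigma> = smult k ([:- u, 1:] * ([:- u, 1:] * [:- r, 1:]))"
        unfolding \<sigma> 4(1) by (simp only: mult_ac)
      from double_simple[OF this] show ?thesis using 4 by auto
    next
      case 5
      define a t where "a = s - r" and "t = (u - r) / a"
      have a: "a \<noteq> 0" and s: "s = r + a" using 5 by (auto simp: a_def)
      have u: "u = r + a * t" using a by (simp add: t_def)
      have t: "t \<noteq> 0" "t \<noteq> 1" using 5 s u by auto
      show ?thesis
        by (rule classified_affineI[OF a _ assms(1) _ classified_normalized deg,
              of "k * a" r "[:0, t, - (1 + t), 1:]"])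
          (use a k t in \<open>simp_all add: \<sigma> s u pcompose_smult pcompose_mult pcompose_pCons
              power2_eq_square algebra_simps\<close>)
    qed
  qed
qed

theorem theorem3p6:
  fixes A :: operator
  assumes "heun_class A"
  shows "(\<exists>B. A \<leadsto> B \<and> riemann_class B)
    \<or> (\<exists>T. \<forall>v c. c \<noteq> 0 \<longrightarrow> (\<exists>B. A \<leadsto> B \<and> normal_form v c T B))
    \<or> (\<exists>B. A \<leadsto> B \<and> z_times_riemann B)"
proof -
  obtain \<sigma> \<tau> \<xi> where "\<sigma> \<noteq> 0" "degree \<sigma> \<le> 3" "degree \<tau> \<le> 2" "degree \<xi> \<le> 4"
    and A: "A = poly_op \<sigma> \<tau> \<xi>"
    using assms unfolding heun_class_def by blast
  then have "classified A"
    unfolding A by (intro classified_poly_op)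
  then show ?thesis unfolding classified_def .
qed

end
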